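(* Let $\mathbb{Z}_2=\langle\gamma\rangle$ and let $(G,p,\ell)$ be a $\mathbb{Z}_2$-regular point-line framework in $\mathbb{R}^2$, $G=(V_P\cup V_H,E)$, with respect to $\theta:\mathbb{Z}_2\to\mathrm{Aut}_{PH}(G)$ and $\tau:\mathbb{Z}_2\to\mathcal{C}_2$. Suppose that $\gamma$ fixes each $i\in V_H$ and that $\theta$ acts freely on $V_P$. Then $(G,p,\ell)$ is isostatic if and only if $G$ is $(2,3)$-tight and $|E_\gamma|=1$.
   Context: $\mathcal{C}_2\subset O(\mathbb{R}^2)$ is generated by the half-turn about the origin; $\tau$ is an isomorphism onto it. $\mathrm{Aut}_{PH}(G)$ consists of automorphisms mapping $V_P$ to $V_P$ and $V_H$ to $V_H$. Write $\delta i=\theta(\delta)(i)$. Point-line framework: $p:V_P\to\mathbb{R}^2$, $\ell=(a,r):V_H\to\mathbb{S}^1\times\mathbb{R}$ (vertex $j$ is the line $\{x:\langle a_j,x\rangle+r_j=0\}$), affinely spanning $\mathbb{R}^2$. Infinitesimal motions $(\dot p,\dot a,\dot r)$: $\langle p_i-p_j,\dot p_i-\dot p_j\rangle=0$ (point-point edges), $\langle p_i,\dot a_j\rangle+\langle\dot p_i,a_j\rangle+\dot r_j=0$ (edges $i\in V_P$, $j\in V_H$), $\langle a_i,\dot a_j\rangle+\langle\dot a_i,a_j\rangle=0$ (line-line edges), $\langle a_i,\dot a_i\rangle=0$ ($i\in V_H$). Infinitesimally rigid: motion space of dimension 3. Isostatic: infinitesimally rigid and removing any edge destroys infinitesimal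 rigidity. $\mathbb{Z}_2$-symmetric: $\tau(\delta)p(i)=p(\delta i)$, $\tau(\delta)a(j)=\pm a(\delta j)$, $r(j)=r(\delta j)$. $\mathbb{Z}_2$-regular: the coefficient matrix of the motion system has maximum rank among all $\mathbb{Z}_2$-symmetric point-line realisations of $G$ w.r.t. $\theta,\tau$ with the same partition. $G=(V,E)$ is $(2,3)$-tight if $|E|=2|V|-3$ and every subgraph $(V',E')$ with $|E'|>0$ has $|E'|\le2|V'|-3$. $E_\gamma$ is the set of edges $\{i,j\}$ fixed by $\gamma$, i.e. with $\gamma i=i,\gamma j=j$ or $\gamma i=j,\gamma j=i$. *)

theory Defs
  imports
    "HOL-Analysis.Analysis"
    "HOL-Algebra.Bij"
    "HOL-Algebra.Elementary_Groups"
begin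

text \<open>
  Vertices are drawn from a finite type \<open>'v\<close>; the vertex set is \<open>VP \<union> VH\<close>, which may be any
  subset of the type. Edges are two-element sets of vertices. All configurations and velocities are
  indexed by the whole type; only the values of \<open>p\<close> on \<open>VP\<close> and of \<open>L = (a, r)\<close> on \<open>VH\<close> matter.
\<close>

definition point_line_graph :: "'v set \<Rightarrow> 'v set \<Rightarrow> 'v set set \<Rightarrow> bool" where
  "point_line_graph VP VH E \<longleftrightarrow>
     finite VP \<and> finite VH \<and> VP \<inter> VH = {} \<and> (\<forall>e\<in>E. e \<subseteq> VP \<union> VH \<and> card e = 2)"

definition line_of :: "(real^2) \<times> real \<Rightarrow> (real^2) set" where
  "line_of l = {x. fst l \<bullet> x + snd l = 0}"

definition point_line_framework ::
  "'v set \<Rightarrow> 'v set \<Rightarrow> 'v set set \<Rightarrow> ('v \<Rightarrow> real^2) \<Rightarrow> ('v \<Rightarrow> (real^2) \<times> real) \<Rightarrow> bool" where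
  "point_line_framework VP VH E p L \<longleftrightarrow>
     point_line_graph VP VH E \<and>
     (\<forall>j\<in>VH. norm (fst (L j)) = 1) \<and>
     affine hull (p ` VP \<union> (\<Union>j\<in>VH. line_of (L j))) = UNIV"

text \<open>
  Velocities are normalised to \<open>0\<close> at indices where they have no meaning, so that the
  dimension of this subspace is the dimension of the space of infinitesimal motions.
\<close>

definition velocity_supported ::
  "'v set \<Rightarrow> 'v set \<Rightarrow> (real^2)^'v::finite \<Rightarrow> (real^2)^'v \<Rightarrow> real^'v \<Rightarrow> bool" where
  "velocity_supported VP VH dp da dr \<longleftrightarrow>
     (\<forall>i. i \<notin> VP \<longrightarrow> dp $ i = 0) \<and> (\<forall>j. j \<notin> VH \<longrightarrow> da $ j = 0 \<and> dr $ j = 0)"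

definition infinitesimal_motions ::
  "'v::finite set \<Rightarrow> 'v set \<Rightarrow> 'v set set \<Rightarrow> ('v \<Rightarrow> real^2) \<Rightarrow> ('v \<Rightarrow> (real^2) \<times> real)
   \<Rightarrow> (((real^2)^'v) \<times> ((real^2)^'v) \<times> (real^'v)) set" where
  "infinitesimal_motions VP VH E p L =
     {(dp, da, dr).
        velocity_supported VP VH dp da dr \<and>
        (\<forall>i\<in>VP. \<forall>j\<in>VP. {i, j} \<in> E \<longrightarrow> (p i - p j) \<bullet> (dp $ i - dp $ j) = 0) \<and>
        (\<forall>i\<in>VP. \<forall>j\<in>VH. {i, j} \<in> E \<longrightarrow>
           p i \<bullet> (da $ j) + (dp $ i) \<bullet> fst (L j) + dr $ j = 0) \<and>
        (\<forall>i\<in>VH. \<forall>j\<in>VH. {i, j} \<in> E \<longrightarrow>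
           fst (L i) \<bullet> (da $ j) + (da $ i) \<bullet> fst (L j) = 0) \<and>
        (\<forall>i\<in>VH. fst (L i) \<bullet> (da $ i) = 0)}"

definition infinitesimally_rigid ::
  "'v::finite set \<Rightarrow> 'v set \<Rightarrow> 'v set set \<Rightarrow> ('v \<Rightarrow> real^2) \<Rightarrow> ('v \<Rightarrow> (real^2) \<times> real) \<Rightarrow> bool" where
  "infinitesimally_rigid VP VH E p L \<longleftrightarrow> dim (infinitesimal_motions VP VH E p L) = 3"

definition isostatic ::
  "'v::finite set \<Rightarrow> 'v set \<Rightarrow> 'v set set \<Rightarrow> ('v \<Rightarrow> real^2) \<Rightarrow> ('v \<Rightarrow> (real^2) \<times> real) \<Rightarrow> bool" where
  "isostatic VP VH E p L \<longleftrightarrow>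
     infinitesimally_rigid VP VH E p L \<and>
     (\<forall>e\<in>E. \<not> infinitesimally_rigid VP VH (E - {e}) p L)"

text \<open>
  The coefficient matrix of the motion system. A row \<open>Inl e\<close> belongs to the edge \<open>e\<close> and a row
  \<open>Inr h\<close> to the normalisation equation of the line \<open>h\<close>; the column blocks \<open>Inl (i, k)\<close>,
  \<open>Inr (Inl (j, k))\<close>, \<open>Inr (Inr j)\<close> belong to the \<open>k\<close>-th coordinate of the velocity of \<open>p i\<close>, to the
  \<open>k\<close>-th coordinate of the velocity of \<open>a j\<close>, and to the velocity of \<open>r j\<close>. Rows and columns that do
  not belong to the system are zero and do not affect the rank.
\<close>

definition other_end :: "'v set \<Rightarrow> 'v \<Rightarrow> 'v" where
  "other_end e i = (THE j. e = {i, j})"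

definition coeff_p ::
  "'v set \<Rightarrow> 'v set \<Rightarrow> 'v set set \<Rightarrow> ('v \<Rightarrow> real^2) \<Rightarrow> ('v \<Rightarrow> (real^2) \<times> real)
   \<Rightarrow> 'v set + 'v \<Rightarrow> 'v \<Rightarrow> real^2" where
  "coeff_p VP VH E p L \<rho> i =
     (case \<rho> of
        Inl e \<Rightarrow>
          if e \<in> E \<and> i \<in> e \<and> i \<in> VP
          then (let j = other_end e i in if j \<in> VP then p i - p j else fst (L j))
          else 0
      | Inr h \<Rightarrow> 0)"

definition coeff_a ::
  "'v set \<Rightarrow> 'v set \<Rightarrow> 'v set set \<Rightarrow> ('v \<Rightarrow> real^2) \<Rightarrow> ('v \<Rightarrow> (real^2) \<times> real)
   \<Rightarrow> 'v set + 'v \<Rightarrow> 'v \<Rightarrow> real^2" where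
  "coeff_a VP VH E p L \<rho> j =
     (case \<rho> of
        Inl e \<Rightarrow>
          if e \<in> E \<and> j \<in> e \<and> j \<in> VH
          then (let i = other_end e j in if i \<in> VP then p i else fst (L i))
          else 0
      | Inr h \<Rightarrow> if h = j \<and> h \<in> VH then fst (L h) else 0)"

definition coeff_r ::
  "'v set \<Rightarrow> 'v set \<Rightarrow> 'v set set \<Rightarrow> 'v set + 'v \<Rightarrow> 'v \<Rightarrow> real" where
  "coeff_r VP VH E \<rho> j =
     (case \<rho> of
        Inl e \<Rightarrow> if e \<in> E \<and> j \<in> e \<and> j \<in> VH \<and> other_end e j \<in> VP then 1 else 0
      | Inr h \<Rightarrow> 0)"

definition rigidity_matrix ::
  "'v::finite set \<Rightarrow> 'v set \<Rightarrow> 'v set set \<Rightarrow> ('v \<Rightarrow> real^2) \<Rightarrow> ('v \<Rightarrow> (real^2) \<times> real)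
   \<Rightarrow> real ^ (('v \<times> 2) + ('v \<times> 2) + 'v) ^ ('v set + 'v)" where
  "rigidity_matrix VP VH E p L =
     (\<chi> \<rho> c. case c of
        Inl (i, k) \<Rightarrow> coeff_p VP VH E p L \<rho> i $ k
      | Inr (Inl (j, k)) \<Rightarrow> coeff_a VP VH E p L \<rho> j $ k
      | Inr (Inr j) \<Rightarrow> coeff_r VP VH E \<rho> j)"

definition velocity_vector ::
  "(real^2)^'v::finite \<Rightarrow> (real^2)^'v \<Rightarrow> real^'v \<Rightarrow> real ^ (('v \<times> 2) + ('v \<times> 2) + 'v)" where
  "velocity_vector dp da dr =
     (\<chi> c. case c of
        Inl (i, k) \<Rightarrow> dp $ i $ k
      | Inr (Inl (j, k)) \<Rightarrow> da $ j $ k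
      | Inr (Inr j) \<Rightarrow> dr $ j)"

lemma sum_UNIV_sum:
  fixes f :: "'a::finite + 'b::finite \<Rightarrow> real"
  shows "sum f UNIV = (\<Sum>x\<in>UNIV. f (Inl x)) + (\<Sum>y\<in>UNIV. f (Inr y))"
  by (simp add: UNIV_Plus_UNIV[symmetric] sum.Plus del: UNIV_Plus_UNIV)

lemma sum_UNIV_vec2:
  fixes f g :: "'v::finite \<Rightarrow> real^2"
  shows "(\<Sum>x\<in>UNIV. (case x of (i, k) \<Rightarrow> f i $ k) * (case x of (i, k) \<Rightarrow> g i $ k)) = (\<Sum>i\<in>UNIV. f i \<bullet> g i)"
  by (simp add: inner_vec_def sum.cartesian_product case_prod_unfold)

lemma rigidity_matrix_row:
  "(rigidity_matrix VP VH E p L *v velocity_vector dp da dr) $ \<rho> =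
     (\<Sum>i\<in>UNIV. coeff_p VP VH E p L \<rho> i \<bullet> (dp $ i)) +
     (\<Sum>j\<in>UNIV. coeff_a VP VH E p L \<rho> j \<bullet> (da $ j)) +
     (\<Sum>j\<in>UNIV. coeff_r VP VH E \<rho> j * dr $ j)"
  by (simp add: matrix_vector_mult_def rigidity_matrix_def velocity_vector_def sum_UNIV_sum
      sum_UNIV_vec2[of "\<lambda>i. coeff_p VP VH E p L \<rho> i" "\<lambda>i. dp $ i"]
      sum_UNIV_vec2[of "\<lambda>i. coeff_a VP VH E p L \<rho> i" "\<lambda>i. da $ i"])

lemma other_end_simps:
  "other_end {i, j} i = j" "other_end {i, j} j = i"
  unfolding other_end_def by (rule the_equality; auto simp: doubleton_eq_iff)+

lemma rigidity_matrix_edge_row: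
  assumes "{i, j} \<in> E" "i \<noteq> j"
  shows "(rigidity_matrix VP VH E p L *v velocity_vector dp da dr) $ Inl {i, j} =
     coeff_p VP VH E p L (Inl {i, j}) i \<bullet> (dp $ i) + coeff_p VP VH E p L (Inl {i, j}) j \<bullet> (dp $ j) +
     (coeff_a VP VH E p L (Inl {i, j}) i \<bullet> (da $ i) + coeff_a VP VH E p L (Inl {i, j}) j \<bullet> (da $ j)) +
     (coeff_r VP VH E (Inl {i, j}) i * dr $ i + coeff_r VP VH E (Inl {i, j}) j * dr $ j)"
proof -
  have *: "sum f UNIV = f i + f j" if "\<And>k. k \<notin> {i, j} \<Longrightarrow> f k = 0" for f :: "'a \<Rightarrow> real"
  proof -
    have "sum f UNIV = sum f {i, j}"
      using that by (intro sum.mono_neutral_right) auto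
    then show ?thesis using assms by simp
  qed
  show ?thesis
    unfolding rigidity_matrix_row
    by (intro arg_cong2[where f = "(+)"] *) (auto simp: coeff_p_def coeff_a_def coeff_r_def)
qed

lemma rigidity_matrix_line_row:
  "(rigidity_matrix VP VH E p L *v velocity_vector dp da dr) $ Inr h =
     (if h \<in> VH then fst (L h) \<bullet> (da $ h) else 0)"
proof -
  have "(\<Sum>j\<in>UNIV. coeff_a VP VH E p L (Inr h) j \<bullet> (da $ j)) =
        (\<Sum>j\<in>UNIV. if h = j then (if h \<in> VH then fst (L h) \<bullet> (da $ h) else 0) else 0)"
    by (intro sum.cong) (auto simp: coeff_a_def)
  then show ?thesis
    by (simp add: rigidity_matrix_row) (simp add: coeff_p_def coeff_r_def)
qed

lemma infinitesimal_motions_iff_rigidity_matrix: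
  assumes G: "point_line_graph VP VH E"
  shows "(dp, da, dr) \<in> infinitesimal_motions VP VH E p L \<longleftrightarrow>
     velocity_supported VP VH dp da dr \<and>
     rigidity_matrix VP VH E p L *v velocity_vector dp da dr = 0"
    (is "_ \<longleftrightarrow> _ \<and> ?Ax = 0")
proof -
  have disj: "\<And>i. i \<in> VP \<Longrightarrow> i \<notin> VH" using G by (auto simp: point_line_graph_def)
  have ne: "i \<noteq> j" if "{i, j} \<in> E" for i j
  proof
    assume "i = j"
    with that G have "card {i} = 2" unfolding point_line_graph_def by fastforce
    then show False by simp
  qed
  have edge: "\<exists>i j. e = {i, j} \<and>
      (i \<in> VP \<and> j \<in> VP \<or> i \<in> VP \<and> j \<in> VH \<or> i \<in> VH \<and> j \<in> VH)" if "e \<in> E" for e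
  proof -
    have "card e = 2" "e \<subseteq> VP \<union> VH" using that G by (auto simp: point_line_graph_def)
    then obtain i j where "e = {i, j}" "i \<in> VP \<union> VH" "j \<in> VP \<union> VH"
      by (auto simp: card_2_iff)
    moreover have "{i, j} = {j, i}" by (rule insert_commute)
    ultimately show ?thesis by blast
  qed
  have pp: "?Ax $ Inl {i, j} = (p i - p j) \<bullet> (dp $ i - dp $ j)"
    if "{i, j} \<in> E" "i \<in> VP" "j \<in> VP" for i j
    using that ne[OF that(1)] disj
    by (simp add: rigidity_matrix_edge_row coeff_p_def coeff_a_def coeff_r_def other_end_simps
        algebra_simps)
  have pl: "?Ax $ Inl {i, j} = p i \<bullet> (da $ j) + (dp $ i) \<bullet> fst (L j) + dr $ j"
    if "{i, j} \<in> E" "i \<in> VP" "j \<in> VH" for i j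
    using that ne[OF that(1)] disj
    by (auto simp add: rigidity_matrix_edge_row coeff_p_def coeff_a_def coeff_r_def other_end_simps
        inner_commute)
  have ll: "?Ax $ Inl {i, j} = fst (L i) \<bullet> (da $ j) + (da $ i) \<bullet> fst (L j)"
    if "{i, j} \<in> E" "i \<in> VH" "j \<in> VH" for i j
    using that ne[OF that(1)] disj
    by (auto simp add: rigidity_matrix_edge_row coeff_p_def coeff_a_def coeff_r_def other_end_simps
        inner_commute)
  have non: "?Ax $ Inl e = 0" if "e \<notin> E" for e
    using that by (simp add: rigidity_matrix_row coeff_p_def coeff_a_def coeff_r_def)
  have rows: "?Ax = 0 \<longleftrightarrow> (\<forall>e\<in>E. ?Ax $ Inl e = 0) \<and> (\<forall>h\<in>VH. fst (L h) \<bullet> (da $ h) = 0)"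
  proof -
    have "?Ax = 0 \<longleftrightarrow> (\<forall>e. ?Ax $ Inl e = 0) \<and> (\<forall>h. ?Ax $ Inr h = 0)"
      by (simp add: vec_eq_iff split_sum_all)
    then show ?thesis using non by (auto simp: rigidity_matrix_line_row)
  qed
  have "(\<forall>e\<in>E. ?Ax $ Inl e = 0) \<longleftrightarrow>
      (\<forall>i\<in>VP. \<forall>j\<in>VP. {i, j} \<in> E \<longrightarrow> ?Ax $ Inl {i, j} = 0) \<and>
      (\<forall>i\<in>VP. \<forall>j\<in>VH. {i, j} \<in> E \<longrightarrow> ?Ax $ Inl {i, j} = 0) \<and>
      (\<forall>i\<in>VH. \<forall>j\<in>VH. {i, j} \<in> E \<longrightarrow> ?Ax $ Inl {i, j} = 0)"
    (is "?L \<longleftrightarrow> ?R")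
  proof
    assume ?L then show ?R by blast
  next
    assume R: ?R
    show ?L
    proof
      fix e assume "e \<in> E"
      with edge[OF this] R show "?Ax $ Inl e = 0" by blast
    qed
  qed
  then show ?thesis
    unfolding rows infinitesimal_motions_def by (simp add: pp pl ll)
qed

abbreviation Z2 :: "int monoid" where
  "Z2 \<equiv> integer_mod_group 2"

definition orthogonal_group :: "(real^2 \<Rightarrow> real^2) monoid" where
  "orthogonal_group =
     \<lparr>carrier = {f. orthogonal_transformation f}, monoid.mult = (\<circ>), one = id\<rparr>"

definition half_turn_group :: "(real^2 \<Rightarrow> real^2) monoid" where
  "half_turn_group = subgroup_generated orthogonal_group {\<lambda>x. - x}"

definition Aut_PH :: "'v set \<Rightarrow> 'v set \<Rightarrow> 'v set set \<Rightarrow> ('v \<Rightarrow> 'v) monoid" where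
  "Aut_PH VP VH E =
     BijGroup (VP \<union> VH)
       \<lparr>carrier := {\<pi> \<in> Bij (VP \<union> VH).
          \<pi> ` VP = VP \<and> \<pi> ` VH = VH \<and>
          (\<forall>i\<in>VP \<union> VH. \<forall>j\<in>VP \<union> VH. {\<pi> i, \<pi> j} \<in> E \<longleftrightarrow> {i, j} \<in> E)}\<rparr>"

text \<open>The sign in the condition on normals may depend on both the group element and the line.\<close>

definition Z2_symmetric ::
  "'v set \<Rightarrow> 'v set \<Rightarrow> (int \<Rightarrow> 'v \<Rightarrow> 'v) \<Rightarrow> (int \<Rightarrow> real^2 \<Rightarrow> real^2)
   \<Rightarrow> ('v \<Rightarrow> real^2) \<Rightarrow> ('v \<Rightarrow> (real^2) \<times> real) \<Rightarrow> bool" where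
  "Z2_symmetric VP VH \<theta> \<tau> p L \<longleftrightarrow>
     (\<forall>\<delta>\<in>carrier Z2.
        (\<forall>i\<in>VP. \<tau> \<delta> (p i) = p (\<theta> \<delta> i)) \<and>
        (\<forall>j\<in>VH.
           (\<tau> \<delta> (fst (L j)) = fst (L (\<theta> \<delta> j)) \<or> \<tau> \<delta> (fst (L j)) = - fst (L (\<theta> \<delta> j))) \<and>
           snd (L j) = snd (L (\<theta> \<delta> j))))"

definition Z2_regular ::
  "'v::finite set \<Rightarrow> 'v set \<Rightarrow> 'v set set \<Rightarrow> (int \<Rightarrow> 'v \<Rightarrow> 'v) \<Rightarrow> (int \<Rightarrow> real^2 \<Rightarrow> real^2)
   \<Rightarrow> ('v \<Rightarrow> real^2) \<Rightarrow> ('v \<Rightarrow> (real^2) \<times> real) \<Rightarrow> bool" where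
  "Z2_regular VP VH E \<theta> \<tau> p L \<longleftrightarrow>
     point_line_framework VP VH E p L \<and> Z2_symmetric VP VH \<theta> \<tau> p L \<and>
     (\<forall>p' L'. point_line_framework VP VH E p' L' \<and> Z2_symmetric VP VH \<theta> \<tau> p' L' \<longrightarrow>
        rank (rigidity_matrix VP VH E p' L') \<le> rank (rigidity_matrix VP VH E p L))"

definition acts_freely_on :: "(int \<Rightarrow> 'v \<Rightarrow> 'v) \<Rightarrow> 'v set \<Rightarrow> bool" where
  "acts_freely_on \<theta> S \<longleftrightarrow> (\<forall>\<delta>\<in>carrier Z2. \<forall>i\<in>S. \<theta> \<delta> i = i \<longrightarrow> \<delta> = \<one>\<^bsub>Z2\<^esub>)"

definition tight_2_3 :: "'v set \<Rightarrow> 'v set set \<Rightarrow> bool" where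
  "tight_2_3 V E \<longleftrightarrow>
     int (card E) = 2 * int (card V) - 3 \<and>
     (\<forall>V' E'. V' \<subseteq> V \<and> E' \<subseteq> E \<and> (\<forall>e\<in>E'. e \<subseteq> V') \<and> card E' > 0 \<longrightarrow>
        int (card E') \<le> 2 * int (card V') - 3)"

definition fixed_edges :: "'v set set \<Rightarrow> ('v \<Rightarrow> 'v) \<Rightarrow> 'v set set" where
  "fixed_edges E g =
     {e \<in> E. \<exists>i j. e = {i, j} \<and> (g i = i \<and> g j = j \<or> g i = j \<and> g j = i)}"

end

theory Submission
  imports Defs
begin

text \<open>
  Necessity. In an isostatic framework the edge equations are independent on every vertex subset,
  and the three-dimensional space of rigid motions acts faithfully on the ends of every edge; this
  gives the sparsity counts. The velocities that are symmetric under the half-turn form a space of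
  dimension \<open>|V|\<close> which contains the rotation about the origin, and on it the equations of all edge
  orbits remain independent; together with the parity of \<open>|E| = 2|V| - 3\<close> this forces exactly one
  fixed edge.

  Sufficiency. By regularity it is enough to find one symmetric realisation without nontrivial
  motions. A projective map turns the problem into one about bar-joint frameworks with reflection
  symmetry, where the lines become vertices on the mirror. There, following Whiteley's proof of
  Laman's theorem, one prescribes generic edge directions, one for each orbit of edges. The positions
  realising these directions, the symmetric velocities and the antisymmetric velocities each satisfy
  one generic linear equation per edge orbit, taken from the two-dimensional span of the functionals
  \<open>z u - z v\<close> of the two edges of the orbit. Hence the rank is governed by the graphic matroid, where
  \<open>(2,3)\<close>-sparsity gives \<open>|F| + 1 \<le> 2 rank F\<close> for nonempty \<open>F\<close>.
\<close>

section \<open>Linear algebra\<close>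

lemma dim_le_dim_hyperplane_section:
  fixes S :: "'a::euclidean_space set" and f :: "'a \<Rightarrow> real"
  assumes "subspace S" "linear f"
  shows "dim S \<le> dim {x \<in> S. f x = 0} + 1"
proof (cases "\<exists>m\<in>S. f m \<noteq> 0")
  case True
  then obtain m where m: "m \<in> S" "f m \<noteq> 0" by blast
  let ?K = "{x \<in> S. f x = 0}"
  have "S \<subseteq> span (insert m ?K)"
  proof
    fix x assume x: "x \<in> S"
    have "x - (f x / f m) *\<^sub>R m \<in> ?K"
      using x m assms by (auto intro!: subspace_diff subspace_scale simp: linear_diff linear_cmul)
    then have "x - (f x / f m) *\<^sub>R m \<in> span ?K" by (rule span_base)
    then show "x \<in> span (insert m ?K)" by (auto simp: span_insert)
  qed
  then have "dim S \<le> dim (insert m ?K)" by (rule dim_mono)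
  also have "\<dots> \<le> dim ?K + 1" by (simp add: dim_insert)
  finally show ?thesis .
next
  case False
  then have "{x \<in> S. f x = 0} = S" by auto
  then show ?thesis by simp
qed

lemma dim_eq_dim_hyperplane_section:
  fixes S :: "'a::euclidean_space set" and f :: "'a \<Rightarrow> real"
  assumes "subspace S" "linear f" "m \<in> S" "f m \<noteq> 0"
  shows "dim S = dim {x \<in> S. f x = 0} + 1"
proof -
  let ?K = "{x \<in> S. f x = 0}"
  have "subspace ?K"
    using assms by (auto simp: subspace_def linear_0 linear_add linear_cmul)
  then have "span ?K \<subseteq> ?K" by (intro span_minimal) auto
  then have "m \<notin> span ?K" using assms(4) by blast
  then have "dim (insert m ?K) = dim ?K + 1" by (simp add: dim_insert)
  moreover have "dim (insert m ?K) \<le> dim S" using assms(3) by (intro dim_subset) auto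
  ultimately show ?thesis using dim_le_dim_hyperplane_section[OF assms(1,2)] by simp
qed

lemma subspace_common_kernel:
  assumes "subspace S" "\<And>e. e \<in> F \<Longrightarrow> linear (f e)"
  shows "subspace {x \<in> S. \<forall>e\<in>F. f e x = (0::real)}"
  using assms by (auto simp: subspace_def linear_0 linear_add linear_cmul)

lemma dim_le_dim_common_kernel:
  fixes S :: "'a::euclidean_space set" and f :: "'e \<Rightarrow> 'a \<Rightarrow> real"
  assumes "subspace S" "finite F" "\<And>e. e \<in> F \<Longrightarrow> linear (f e)"
  shows "dim S \<le> dim {x \<in> S. \<forall>e\<in>F. f e x = 0} + card F"
  using assms(2,3)
proof (induction F)
  case empty
  show ?case by simp
next
  case (insert e F)
  let ?K = "{x \<in> S. \<forall>e\<in>F. f e x = 0}"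
  have "subspace ?K" using insert.prems assms(1) by (intro subspace_common_kernel) auto
  then have "dim ?K \<le> dim {x \<in> ?K. f e x = 0} + 1"
    using insert.prems by (intro dim_le_dim_hyperplane_section) auto
  moreover have "{x \<in> ?K. f e x = 0} = {x \<in> S. \<forall>e\<in>insert e F. f e x = 0}" by auto
  moreover have "dim S \<le> dim ?K + card F" using insert by auto
  ultimately show ?case using insert.hyps by simp
qed

text \<open>The vectors \<open>m\<close> form a dual system to the functionals. In the induction the
  dual vector of the functional being added lies in the kernel of the others, so every equation
  lowers the dimension by exactly one.\<close>

lemma dim_eq_dim_common_kernel:
  fixes S :: "'a::euclidean_space set" and f :: "'e \<Rightarrow> 'a \<Rightarrow> real"
  assumes "subspace S" "finite F" "\<And>e. e \<in> F \<Longrightarrow> linear (f e)"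
    and "\<And>e. e \<in> F \<Longrightarrow> \<exists>m\<in>S. f e m \<noteq> 0 \<and> (\<forall>e'\<in>F - {e}. f e' m = 0)"
  shows "dim S = dim {x \<in> S. \<forall>e\<in>F. f e x = 0} + card F"
  using assms(2-4)
proof (induction F)
  case empty
  show ?case by simp
next
  case (insert e F)
  let ?K = "{x \<in> S. \<forall>e\<in>F. f e x = 0}"
  obtain m where m: "m \<in> S" "f e m \<noteq> 0" "\<forall>e'\<in>insert e F - {e}. f e' m = 0"
    using insert.prems(2)[of e] by auto
  have "m \<in> ?K" using m insert.hyps by auto
  moreover have "subspace ?K" using insert.prems assms(1) by (intro subspace_common_kernel) auto
  ultimately have "dim ?K = dim {x \<in> ?K. f e x = 0} + 1"
    using insert.prems(1) m by (intro dim_eq_dim_hyperplane_section[where m = m]) auto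
  moreover have "{x \<in> ?K. f e x = 0} = {x \<in> S. \<forall>e\<in>insert e F. f e x = 0}" by auto
  moreover have "dim S = dim ?K + card F"
  proof (rule insert.IH)
    fix e' assume e': "e' \<in> F"
    then obtain m where "m \<in> S" "f e' m \<noteq> 0" "\<forall>e''\<in>insert e F - {e'}. f e'' m = 0"
      using insert.prems(2)[of e'] by auto
    then show "\<exists>m\<in>S. f e' m \<noteq> 0 \<and> (\<forall>e''\<in>F - {e'}. f e'' m = 0)"
      by (intro bexI[of _ m]) auto
  qed (use insert.prems in auto)
  ultimately show ?case using insert.hyps by simp
qed

lemma dim_image_subspace:
  fixes f :: "'a::euclidean_space \<Rightarrow> 'b::euclidean_space"
  assumes "linear f" "subspace S" "\<And>x. x \<in> S \<Longrightarrow> f x = 0 \<Longrightarrow> x = 0"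
  shows "dim (f ` S) = dim S"
proof -
  have "inj_on f S"
    using assms by (simp add: linear_injective_on_subspace_0)
  moreover have "span S = S" using assms(2) by (simp only: span_eq_iff)
  ultimately show ?thesis using dim_image_eq[OF assms(1), of S] by argo
qed

lemma dim_le_dim_linear_inj:
  fixes f :: "'a::euclidean_space \<Rightarrow> 'b::euclidean_space"
  assumes "linear f" "subspace S" "\<And>x. x \<in> S \<Longrightarrow> f x = 0 \<Longrightarrow> x = 0" "f ` S \<subseteq> T"
  shows "dim S \<le> dim T"
  using dim_image_subspace[OF assms(1-3)] dim_subset[OF assms(4)] by simp

lemma dim_orthogonal_complement:
  fixes A :: "'a::euclidean_space set"
  shows "dim {z. \<forall>x\<in>A. x \<bullet> z = 0} + dim A = DIM('a)"
proof -
  have "{z. \<forall>x\<in>A. x \<bullet> z = 0} = {y \<in> UNIV. \<forall>x\<in>span A. orthogonal x y}"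
    by (auto simp: orthogonal_def span_base) (metis inner_commute orthogonal_def orthogonal_to_span)
  then show ?thesis
    using dim_subspace_orthogonal_to_vectors[of "span A" UNIV] by simp
qed

text \<open>
  A generic linear combination of \<open>a e\<close> and \<open>b e\<close> avoids every proper subspace not containing
  both vectors, so the coefficients can be chosen one index at a time, for finitely many systems
  \<open>(W, a, b, k)\<close> simultaneously.
\<close>

lemma generic_combination:
  fixes T :: "('a::euclidean_space set \<times> ('e \<Rightarrow> 'a) \<times> ('e \<Rightarrow> 'a) \<times> nat) set"
  assumes "finite F" "finite T"
    and "\<And>W a b k F'. (W, a, b, k) \<in> T \<Longrightarrow> F' \<subseteq> F \<Longrightarrow> k + card F' \<le> dim (W \<union> a ` F' \<union> b ` F')"
  shows "\<exists>c. \<forall>(W, a, b, k)\<in>T. k + card F \<le> dim (W \<union> (\<lambda>e. a e + c e *\<^sub>R b e) ` F)"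
  using assms
proof (induction F arbitrary: T)
  case empty
  show ?case
  proof (intro exI[of _ "\<lambda>_. 1"] ballI)
    fix t assume "t \<in> T"
    then show "case t of (W, a, b, k) \<Rightarrow> k + card {} \<le> dim (W \<union> (\<lambda>e. a e + 1 *\<^sub>R b e) ` {})"
      using empty.prems(2)[of _ _ _ _ "{}"] by (cases t) auto
  qed
next
  case (insert e F)
  \<comment> \<open>\<open>C\<close> collects the coefficients for which the new vector falls into
    the span although \<open>a e\<close> and \<open>b e\<close> do not both lie there.\<close>
  define C where "C = (\<lambda>W (a :: 'e \<Rightarrow> 'a) b F'. {c. a e + c *\<^sub>R b e \<in> span (W \<union> a ` F' \<union> b ` F') \<and>
    \<not> (a e \<in> span (W \<union> a ` F' \<union> b ` F') \<and> b e \<in> span (W \<union> a ` F' \<union> b ` F'))})"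
  define bad where "bad = (\<Union>((W, a, b, k), F') \<in> T \<times> Pow F. C W a b F')"
  \<comment> \<open>Two distinct such coefficients would put \<open>y\<close>, and then
    \<open>x\<close>, into the span, so each of these sets has at most one element.\<close>
  have "finite {c. x + c *\<^sub>R y \<in> span B \<and> \<not> (x \<in> span B \<and> y \<in> span B)}" for x y :: 'a and B
  proof (rule ccontr)
    let ?C = "{c. x + c *\<^sub>R y \<in> span B \<and> \<not> (x \<in> span B \<and> y \<in> span B)}"
    assume "infinite ?C"
    then obtain c where c: "c \<in> ?C" by (metis finite.emptyI all_not_in_conv)
    with \<open>infinite ?C\<close> have "infinite (?C - {c})" by simp
    then obtain c' where c': "c' \<in> ?C" "c' \<noteq> c" by (metis DiffE finite.emptyI all_not_in_conv insertCI)
    have "(x + c *\<^sub>R y) - (x + c' *\<^sub>R y) \<in> span B" using c c' by (intro span_diff) auto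
    then have "(c - c') *\<^sub>R y \<in> span B" by (simp add: algebra_simps)
    then have "(1 / (c - c')) *\<^sub>R ((c - c') *\<^sub>R y) \<in> span B" by (rule span_scale)
    then have y: "y \<in> span B" using c' by simp
    have "(x + c *\<^sub>R y) - c *\<^sub>R y \<in> span B" using c y by (intro span_diff span_scale) auto
    then show False using c y by simp
  qed
  then have "finite bad" unfolding bad_def C_def using insert by auto
  then obtain c0 where c0: "c0 \<notin> bad"
    using ex_new_if_finite[OF infinite_UNIV_char_0] by blast
  \<comment> \<open>The chosen vector joins the fixed part \<open>W\<close> and \<open>k\<close>
    grows by one, so the claim for \<open>F\<close> and \<open>T'\<close> yields the claim for
    \<open>insert e F\<close> and \<open>T\<close>.\<close>
  define T' where "T' = (\<lambda>(W, a, b, k). (insert (a e + c0 *\<^sub>R b e) W, a, b, k + 1)) ` T"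
  have "\<exists>c. \<forall>(W, a, b, k)\<in>T'. k + card F \<le> dim (W \<union> (\<lambda>e. a e + c e *\<^sub>R b e) ` F)"
  proof (rule insert.IH)
    show "finite T'" using insert.prems by (simp add: T'_def)
  next
    fix W' a b k' F' assume "(W', a, b, k') \<in> T'" and F': "F' \<subseteq> F"
    then obtain W k where t: "(W, a, b, k) \<in> T"
      and W': "W' = insert (a e + c0 *\<^sub>R b e) W" "k' = k + 1" by (auto simp: T'_def)
    let ?B = "W \<union> a ` F' \<union> b ` F'"
    have finF': "finite F'" "e \<notin> F'" using F' insert.hyps finite_subset by auto
    have 1: "k + card F' \<le> dim ?B" using insert.prems(2)[OF t, of F'] F' by auto
    have eq: "dim (W' \<union> a ` F' \<union> b ` F') = dim (insert (a e + c0 *\<^sub>R b e) ?B)"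
      by (rule arg_cong[where f = dim]) (auto simp: W')
    show "k' + card F' \<le> dim (W' \<union> a ` F' \<union> b ` F')"
    proof (cases "a e + c0 *\<^sub>R b e \<in> span ?B")
      case False
      then show ?thesis using 1 unfolding eq by (simp add: W' dim_insert)
    next
      case True
      have "c0 \<notin> C W a b F'"
      proof
        assume "c0 \<in> C W a b F'"
        then have "c0 \<in> bad"
          unfolding bad_def using t F' by (intro UN_I[of "((W, a, b, k), F')"]) auto
        with c0 show False ..
      qed
      \<comment> \<open>Here the new vector adds no dimension. But then \<open>a e\<close> and
        \<open>b e\<close> add none either, and the hypothesis for \<open>insert e F'\<close>
        already supplies the missing one.\<close>
      with True have "a e \<in> span ?B" "b e \<in> span ?B" by (auto simp: C_def)
      then have "W \<union> a ` insert e F' \<union> b ` insert e F' \<subseteq> span ?B"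
        using span_superset[of ?B] by auto
      then have "dim (W \<union> a ` insert e F' \<union> b ` insert e F') \<le> dim ?B" by (rule dim_mono)
      moreover have "k + card (insert e F') \<le> dim (W \<union> a ` insert e F' \<union> b ` insert e F')"
        using F' by (intro insert.prems(2)[OF t]) auto
      ultimately show ?thesis using finF' unfolding eq by (simp add: W' dim_insert)
    qed
  qed
  then obtain c where c: "\<forall>(W, a, b, k)\<in>T'. k + card F \<le> dim (W \<union> (\<lambda>e. a e + c e *\<^sub>R b e) ` F)" by blast
  show ?case
  proof (intro exI[of _ "c(e := c0)"] ballI)
    fix t assume "t \<in> T"
    obtain W a b k where t: "t = (W, a, b, k)" by (cases t)
    have "(insert (a e + c0 *\<^sub>R b e) W, a, b, k + 1) \<in> T'"
      using \<open>t \<in> T\<close> unfolding T'_def t by (force simp: image_iff)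
    then have "k + 1 + card F \<le> dim (insert (a e + c0 *\<^sub>R b e) W \<union> (\<lambda>e. a e + c e *\<^sub>R b e) ` F)"
      using c by auto
    also have "insert (a e + c0 *\<^sub>R b e) W \<union> (\<lambda>e. a e + c e *\<^sub>R b e) ` F =
        W \<union> (\<lambda>e'. a e' + (c(e := c0)) e' *\<^sub>R b e') ` insert e F"
      using insert.hyps by auto
    finally show "case t of (W, a, b, k) \<Rightarrow> k + card (insert e F) \<le>
        dim (W \<union> (\<lambda>e'. a e' + (c(e := c0)) e' *\<^sub>R b e') ` insert e F)"
      using insert.hyps by (simp add: t)
  qed
qed

section \<open>Edge vectors of sparse graphs\<close>

text \<open>Both orientations of an edge occur. The span is the row space of the oriented incidence
  matrix, so its dimension is the rank of \<open>F\<close> in the graphic matroid.\<close>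

definition edge_vectors :: "'v::finite set set \<Rightarrow> (real^'v) set" where
  "edge_vectors F = {axis u 1 - axis v 1 | u v. {u, v} \<in> F}"

lemma dim_axis_image: "dim ((\<lambda>v. axis v 1 :: real^'v::finite) ` C) = card C"
proof -
  have "inj_on (\<lambda>v. axis v 1 :: real^'v) C" by (auto simp: inj_on_def axis_eq_axis)
  then have "card ((\<lambda>v. axis v 1 :: real^'v) ` C) = card C" by (rule card_image)
  moreover have "independent ((\<lambda>v. axis v 1 :: real^'v) ` C)"
    by (rule independent_mono[OF independent_Basis]) (auto simp: axis_in_Basis_iff)
  ultimately show ?thesis by (simp add: dim_eq_card_independent)
qed

lemma inner_axis_axis_real: "(axis u 1 :: real^'v::finite) \<bullet> axis v 1 = (if u = v then 1 else 0)"
  by (simp add: inner_axis_axis)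

text \<open>Coordinate vectors at vertices off the edges are orthogonal to all edge vectors. They
  serve to force solutions to vanish outside the vertex set.\<close>

lemma dim_axes_Un_edge_vectors:
  fixes F :: "'v::finite set set"
  assumes "\<And>e. e \<in> F \<Longrightarrow> e \<inter> N = {}"
  shows "dim ((\<lambda>v. axis v 1) ` N \<union> edge_vectors F) = card N + dim (edge_vectors F)"
proof -
  have "dim ((\<lambda>v. axis v 1) ` N \<union> edge_vectors F) =
      dim ((\<lambda>v. axis v 1 :: real^'v) ` N) + dim (edge_vectors F)"
    using assms by (intro dim_orthogonal_sum)
      (fastforce simp: edge_vectors_def inner_diff_right inner_axis_axis_real)
  then show ?thesis by (simp add: dim_axis_image)
qed

text \<open>
  A connected component on the vertex set \<open>C\<close> contributes \<open>card C - 1\<close> to the dimension, and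
  by sparsity at most \<open>2 * card C - 3\<close> edges.
\<close>

lemma card_less_twice_dim_edge_vectors:
  fixes F :: "'v::finite set set"
  assumes "F \<noteq> {}" "\<And>e. e \<in> F \<Longrightarrow> card e = 2"
    and "\<And>C F'. F' \<subseteq> F \<Longrightarrow> F' \<noteq> {} \<Longrightarrow> (\<And>e. e \<in> F' \<Longrightarrow> e \<subseteq> C) \<Longrightarrow> C \<subseteq> \<Union>F \<Longrightarrow>
      card F' + 3 \<le> 2 * card C"
  shows "card F + 1 \<le> 2 * dim (edge_vectors F)"
  using assms
proof (induction "card F" arbitrary: F rule: less_induct)
  case less
  have fin: "finite F" by simp
  obtain e where e: "e \<in> F" using less.prems(1) by blast
  then obtain u v where uv: "e = {u, v}" using less.prems(2) by (metis card_2_iff)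
  \<comment> \<open>\<open>r\<close> is adjacency in \<open>F\<close> and \<open>C\<close> the
    component of \<open>u\<close>; \<open>F1\<close> will be the edges of this component and
    \<open>F2\<close> the remaining ones.\<close>
  define r where "r = {(x, y). {x, y} \<in> F}"
  define C where "C = r\<^sup>* `` {u}"
  have u: "u \<in> C" by (simp add: C_def)
  have step: "y \<in> C" if "x \<in> C" "{x, y} \<in> F" for x y
    using that unfolding C_def r_def by (auto intro: rtrancl_into_rtrancl)
  define F1 where "F1 = {e \<in> F. e \<subseteq> C}"
  define F2 where "F2 = F - F1"
  have e1: "e \<in> F1" using e step[OF u, of v] u by (auto simp: F1_def uv)
  have CF: "C \<subseteq> \<Union>F"
  proof
    fix x assume "x \<in> C"
    then have "(u, x) \<in> r\<^sup>*" by (simp add: C_def)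
    then show "x \<in> \<Union>F" by (cases rule: rtranclE) (use e uv in \<open>auto simp: r_def\<close>)
  qed
  have F2: "e \<inter> C = {}" if "e \<in> F2" for e
  proof -
    have "e \<in> F" using that by (simp add: F2_def)
    then obtain x y where xy: "e = {x, y}" using less.prems(2) by (metis card_2_iff)
    have "\<not> (x \<in> C \<or> y \<in> C)"
      using that step[of x y] step[of y x] unfolding F2_def F1_def xy by (auto simp: insert_commute)
    then show ?thesis by (simp add: xy)
  qed
  \<comment> \<open>Along a path from \<open>u\<close>, each coordinate vector arises from the
    preceding one by subtracting an edge vector. Hence \<open>F1\<close> has rank at least
    \<open>card C - 1\<close>.\<close>
  have "(\<lambda>v. axis v 1) ` C \<subseteq> span (insert (axis u 1) (edge_vectors F1))"
  proof
    fix z :: "real^'v" assume "z \<in> (\<lambda>v. axis v 1) ` C"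
    then obtain x where x: "(u, x) \<in> r\<^sup>*" "z = axis x 1" by (auto simp: C_def)
    from x(1) have "axis x 1 \<in> span (insert (axis u 1) (edge_vectors F1))"
    proof (induction rule: rtrancl_induct)
      case base
      show ?case by (rule span_base) simp
    next
      case (step x y)
      have "x \<in> C" using step.hyps by (simp add: C_def)
      then have "{x, y} \<in> F1"
        using step.hyps \<open>\<And>x y. x \<in> C \<Longrightarrow> {x, y} \<in> F \<Longrightarrow> y \<in> C\<close> by (auto simp: F1_def r_def)
      then have "axis x 1 - axis y 1 \<in> edge_vectors F1" by (auto simp: edge_vectors_def)
      then have "axis x 1 - axis y 1 \<in> span (insert (axis u 1) (edge_vectors F1))"
        by (intro span_base) simp
      with step.IH have "axis x 1 - (axis x 1 - axis y 1) \<in> span (insert (axis u 1) (edge_vectors F1))"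
        by (rule span_diff)
      then show ?case by simp
    qed
    then show "z \<in> span (insert (axis u 1) (edge_vectors F1))" by (simp add: x)
  qed
  then have "dim ((\<lambda>v. axis v 1 :: real^'v) ` C) \<le> dim (insert (axis u 1) (edge_vectors F1))"
    by (rule dim_mono)
  then have dim1: "card C \<le> dim (edge_vectors F1) + 1"
    by (simp add: dim_axis_image dim_insert split: if_splits)
  have card1: "card F1 + 3 \<le> 2 * card C"
    using e1 CF by (intro less.prems(3)) (auto simp: F1_def)
  \<comment> \<open>\<open>F2\<close> may be empty, so the summand 1 is given up here. The total
    keeps it because \<open>dim1\<close> and \<open>card1\<close> give
    \<open>card F1 + 1 \<le> 2 * dim (edge_vectors F1)\<close>.\<close>
  have dim2: "card F2 \<le> 2 * dim (edge_vectors F2)"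
  proof (cases "F2 = {}")
    case False
    have "F2 \<subset> F" using e e1 by (auto simp: F2_def)
    then have "card F2 < card F" by (rule psubset_card_mono[OF fin])
    then have "card F2 + 1 \<le> 2 * dim (edge_vectors F2)"
    proof (rule less.hyps[OF _ False])
      show "card e = 2" if "e \<in> F2" for e using that less.prems(2) by (simp add: F2_def)
      show "card F' + 3 \<le> 2 * card C"
        if "F' \<subseteq> F2" "F' \<noteq> {}" "\<And>e. e \<in> F' \<Longrightarrow> e \<subseteq> C" "C \<subseteq> \<Union>F2" for C F'
        using that by (intro less.prems(3)) (auto simp: F2_def)
    qed
    then show ?thesis by simp
  qed simp
  have "edge_vectors F = edge_vectors F1 \<union> edge_vectors F2"
    by (auto simp: edge_vectors_def F1_def F2_def)
  moreover have "dim (edge_vectors F1 \<union> edge_vectors F2) = dim (edge_vectors F1) + dim (edge_vectors F2)"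
  proof (rule dim_orthogonal_sum)
    fix x y assume "x \<in> edge_vectors F1" "y \<in> edge_vectors F2"
    then obtain a b c d where x: "x = axis a 1 - axis b 1" "{a, b} \<in> F1"
      and y: "y = axis c 1 - axis d 1" "{c, d} \<in> F2" by (auto simp: edge_vectors_def)
    have "a \<in> C" "b \<in> C" "c \<notin> C" "d \<notin> C" using x(2) F2[OF y(2)] by (auto simp: F1_def)
    then show "x \<bullet> y = 0"
      unfolding x y by (auto simp: inner_diff_right inner_diff_left inner_axis_axis_real)
  qed
  moreover have "card F = card F1 + card F2"
    unfolding F2_def using fin by (subst card_Diff_subset) (auto simp: F1_def card_mono)
  ultimately show ?case using dim1 card1 dim2 by simp
qed

section \<open>Reflection-symmetric bar-joint frameworks\<close>

text \<open>After an injective numbering, the element with the smaller number is taken from each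
  two-element orbit.\<close>

lemma involution_representatives:
  fixes A :: "'a::finite set"
  assumes "\<And>x. x \<in> A \<Longrightarrow> \<phi> x \<in> A" "\<And>x. x \<in> A \<Longrightarrow> \<phi> (\<phi> x) = x"
  obtains R where "R \<subseteq> A" "\<phi> ` R \<inter> R = {}" "inj_on \<phi> R"
    "A = {x \<in> A. \<phi> x = x} \<union> (R \<union> \<phi> ` R)"
    "card A = card {x \<in> A. \<phi> x = x} + 2 * card R"
proof -
  obtain h :: "'a \<Rightarrow> nat" where h: "inj h"
    using finite_imp_inj_to_nat_seg[of "UNIV :: 'a set"] by auto
  define R where "R = {x \<in> A. h x < h (\<phi> x)}"
  have R: "R \<subseteq> A" by (auto simp: R_def)
  have disj: "\<phi> ` R \<inter> R = {}" using assms by (auto simp: R_def)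
  have inj: "inj_on \<phi> R" using assms R by (metis inj_on_def subsetD)
  have A: "A = {x \<in> A. \<phi> x = x} \<union> (R \<union> \<phi> ` R)"
  proof (intro equalityI subsetI)
    fix x assume x: "x \<in> A"
    show "x \<in> {x \<in> A. \<phi> x = x} \<union> (R \<union> \<phi> ` R)"
    proof (cases "h x" "h (\<phi> x)" rule: linorder_cases)
      case less
      then show ?thesis using x by (simp add: R_def)
    next
      case equal
      then show ?thesis using x injD[OF h equal] by simp
    next
      case greater
      then have "\<phi> x \<in> R" using x assms by (simp add: R_def)
      then have "\<phi> (\<phi> x) \<in> \<phi> ` R" by simp
      then show ?thesis using x assms by simp
    qed
  qed (use assms R in auto)
  have ne: "\<phi> x \<noteq> x" if "x \<in> R" for x using that by (auto simp: R_def)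
  have "card A = card {x \<in> A. \<phi> x = x} + card (R \<union> \<phi> ` R)"
  proof (subst A, rule card_Un_disjoint)
    have "\<phi> (\<phi> x) \<noteq> \<phi> x" if "x \<in> R" for x
      using ne[OF that] assms(2) that R by auto
    then show "{x \<in> A. \<phi> x = x} \<inter> (R \<union> \<phi> ` R) = {}" using ne by auto
  qed auto
  also have "card (R \<union> \<phi> ` R) = card R + card (\<phi> ` R)"
    using disj by (intro card_Un_disjoint) auto
  also have "card (\<phi> ` R) = card R" by (rule card_image[OF inj])
  finally show ?thesis using that[OF R disj inj A] by simp
qed

text \<open>
  The positions realising prescribed edge slopes \<open>c\<close>, the symmetric velocities and the antisymmetric
  velocities are the kernels of three systems with one row per edge orbit, each a combination of the
  vectors \<open>a e\<close> and \<open>b e\<close>. For \<open>e\<close> in a set of edge orbits these vectors span the edge vectors of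
  the orbits.
\<close>

lemma reflection_symmetric_realisation:
  fixes V :: "'v::finite set" and E :: "'v set set" and g :: "'v \<Rightarrow> 'v"
  assumes gg: "\<And>v. g (g v) = v" and gV: "\<And>v. v \<in> V \<Longrightarrow> g v \<in> V"
    and E: "\<And>e. e \<in> E \<Longrightarrow> e \<subseteq> V \<and> card e = 2"
    and gE: "\<And>e. e \<in> E \<Longrightarrow> g ` e \<in> E"
    and cardE: "card E + 3 = 2 * card V"
    and sparse: "\<And>C F. C \<subseteq> V \<Longrightarrow> F \<subseteq> E \<Longrightarrow> F \<noteq> {} \<Longrightarrow> (\<And>e. e \<in> F \<Longrightarrow> e \<subseteq> C) \<Longrightarrow>
      card F + 3 \<le> 2 * card C"
    and fixed: "{e \<in> E. g ` e = e} = {f}"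
  obtains X Y :: "'v \<Rightarrow> real"
  where "\<forall>v. X (g v) = - X v" "\<forall>v. Y (g v) = Y v" "\<forall>v\<in>V. g v \<noteq> v \<longrightarrow> X v \<noteq> 0"
    "\<forall>u v. {u, v} \<in> E \<longrightarrow> g ` {u, v} \<noteq> {u, v} \<longrightarrow> Y u \<noteq> Y v"
    "dim {w :: (real^2)^'v. (\<forall>v. v \<notin> V \<longrightarrow> w $ v = 0) \<and>
      (\<forall>u v. {u, v} \<in> E \<longrightarrow>
        (X u - X v) * (w $ u $ 1 - w $ v $ 1) + (Y u - Y v) * (w $ u $ 2 - w $ v $ 2) = 0)} \<le> 3"
proof -
  have ggE: "g ` g ` e = e" for e by (simp add: image_image gg)
  obtain R where R: "R \<subseteq> E" "(`) g ` R \<inter> R = {}" "inj_on ((`) g) R"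
    "E = {e \<in> E. g ` e = e} \<union> (R \<union> (`) g ` R)"
    "card E = card {e \<in> E. g ` e = e} + 2 * card R"
  proof (rule involution_representatives[of E "(`) g"])
    show "g ` e \<in> E" "g ` g ` e = e" if "e \<in> E" for e using gE[OF that] ggE by auto
  qed
  have cardR: "card V = card R + 2" using R(5) cardE by (simp add: fixed)
  have fE: "f \<in> E" "g ` f = f" using fixed by auto
  have fR: "f \<notin> R \<union> (`) g ` R" using fE(2) R(2) ggE by auto
  have "\<exists>u v. e = {u, v} \<and> u \<noteq> v" if "e \<in> E" for e using E[OF that] by (auto simp: card_2_iff)
  then obtain U W where UW: "\<And>e. e \<in> E \<Longrightarrow> e = {U e, W e} \<and> U e \<noteq> W e" by metis

  \<comment> \<open>Row vectors of the edge orbits and their ranks\<close>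
  define al where "al u v = (axis u 1 - axis v 1 :: real^'v)" for u v
  have al_inner: "al u v \<bullet> z = z $ u - z $ v" for u v z
    by (simp add: al_def inner_diff_left inner_axis')
  \<comment> \<open>With \<open>X v = z $ v - z $ g v\<close> and
    \<open>Y v = z $ v + z $ g v\<close>, pairing \<open>z\<close> with \<open>a e\<close> and
    \<open>b e\<close> gives the differences of \<open>X\<close> and \<open>Y\<close> along
    \<open>e\<close>. A single vector \<open>z\<close> thus encodes both coordinates of a symmetric
    configuration.\<close>
  define a where "a e = al (U e) (W e) - al (g (U e)) (g (W e))" for e
  define b where "b e = al (U e) (W e) + al (g (U e)) (g (W e))" for e
  \<comment> \<open>Vectors are indexed by the whole type; \<open>B\<close> forces the coordinates
    outside \<open>V\<close> to vanish and has rank \<open>k\<close>.\<close>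
  define B where "B = (\<lambda>v. axis v 1 :: real^'v) ` (- V)"
  define k where "k = card (- V)"
  \<comment> \<open>The orbit of the fixed edge has a single element, so it supplies one row without
    a free coefficient.\<close>
  define x0 where "x0 = al (U f) (W f)"
  have kV: "k + card V = CARD('v)"
    by (simp add: k_def Compl_eq_Diff_UNIV card_Diff_subset card_mono)
  \<comment> \<open>The two edge vectors of an orbit are, up to sign, half the sum and half the
    difference of \<open>a e\<close> and \<open>b e\<close>.\<close>
  have al_span: "al u v \<in> span (a ` F \<union> b ` F)" if FR: "F \<subseteq> R" and uv: "{u, v} \<in> F \<union> (`) g ` F" for u v F
  proof -
    obtain e where e: "e \<in> F" "{u, v} = e \<or> {u, v} = g ` e" using uv by auto
    then have eE: "e = {U e, W e}" using UW FR R(1) by blast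
    have s: "a e \<in> span (a ` F \<union> b ` F)" "b e \<in> span (a ` F \<union> b ` F)"
      using e by (auto intro: span_base)
    have "al (U e) (W e) = (1/2) *\<^sub>R (a e + b e)" by (simp add: a_def b_def flip: scaleR_2)
    then have 1: "al (U e) (W e) \<in> span (a ` F \<union> b ` F)" using s by (simp add: span_scale span_add)
    have "al (g (U e)) (g (W e)) = (1/2) *\<^sub>R (b e - a e)" by (simp add: a_def b_def flip: scaleR_2)
    then have 2: "al (g (U e)) (g (W e)) \<in> span (a ` F \<union> b ` F)"
      using s by (simp add: span_scale span_diff)
    have al_swap: "al v u = - al u v" for u v by (simp add: al_def)
    have "{u, v} = {U e, W e} \<or> {u, v} = {g (U e), g (W e)}"
      using e(2) eE by (metis image_empty image_insert)
    then consider "u = U e" "v = W e" | "v = U e" "u = W e"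
      | "u = g (U e)" "v = g (W e)" | "v = g (U e)" "u = g (W e)"
      by (metis doubleton_eq_iff)
    then show ?thesis
      using 1 2 by cases (simp_all add: al_swap[of "W _" "U _"] al_swap[of "g (W _)" "g (U _)"] span_neg)
  qed
  \<comment> \<open>Sparsity gives \<open>2 * card F + 1 \<le> 2 * dim (edge_vectors F')\<close>,
    and integrality improves this to \<open>card F + 1 \<le> dim (edge_vectors F')\<close>.\<close>
  have rank: "k + card F + 1 \<le> dim (B \<union> edge_vectors F')"
    if "F \<subseteq> R" "F' \<subseteq> E" "F' \<noteq> {}" "2 * card F \<le> card F'" for F F'
  proof -
    have "card F' + 1 \<le> 2 * dim (edge_vectors F')"
    proof (rule card_less_twice_dim_edge_vectors[OF that(3)])
      show "card e = 2" if "e \<in> F'" for e using that \<open>F' \<subseteq> E\<close> E by auto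
      show "card F'' + 3 \<le> 2 * card C"
        if "F'' \<subseteq> F'" "F'' \<noteq> {}" "\<And>e. e \<in> F'' \<Longrightarrow> e \<subseteq> C" "C \<subseteq> \<Union>F'" for C F''
        using that \<open>F' \<subseteq> E\<close> E by (intro sparse) blast+
    qed
    moreover have "dim (B \<union> edge_vectors F') = k + dim (edge_vectors F')"
      unfolding B_def k_def using that E by (intro dim_axes_Un_edge_vectors) blast
    ultimately show ?thesis using that(4) by simp
  qed
  have lift_card: "card (F \<union> (`) g ` F) = 2 * card F" if "F \<subseteq> R" for F
  proof -
    have "card (F \<union> (`) g ` F) = card F + card ((`) g ` F)"
      using R(2) that by (intro card_Un_disjoint) auto
    also have "card ((`) g ` F) = card F" using R(3) that by (intro card_image) (rule inj_on_subset)
    finally show ?thesis by simp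
  qed
  have lift_sub: "F \<union> (`) g ` F \<subseteq> E" if "F \<subseteq> R" for F using that R(1) gE by blast
  have ev_sub: "edge_vectors (F \<union> (`) g ` F) \<subseteq> span (D \<union> a ` F \<union> b ` F)" if "F \<subseteq> R" for F D
  proof
    fix x assume "x \<in> edge_vectors (F \<union> (`) g ` F)"
    then obtain u v where "x = al u v" "{u, v} \<in> F \<union> (`) g ` F"
      by (auto simp: edge_vectors_def al_def)
    then have "x \<in> span (a ` F \<union> b ` F)" using al_span[OF that] by simp
    then show "x \<in> span (D \<union> a ` F \<union> b ` F)"
      using span_mono[of "a ` F \<union> b ` F" "D \<union> a ` F \<union> b ` F"] by blast
  qed
  have rank1: "k + card F + 1 \<le> dim (D \<union> a ` F \<union> b ` F)" if "F \<subseteq> R" "F \<noteq> {}" "B \<subseteq> D" for F D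
  proof -
    have "k + card F + 1 \<le> dim (B \<union> edge_vectors (F \<union> (`) g ` F))"
      using rank[OF that(1) lift_sub[OF that(1)]] lift_card[OF that(1)] that(2) by auto
    also have "\<dots> \<le> dim (D \<union> a ` F \<union> b ` F)"
      using ev_sub[OF that(1)] that(3) span_superset[of "D \<union> a ` F \<union> b ` F"] by (intro dim_mono) blast
    finally show ?thesis .
  qed
  \<comment> \<open>The edge \<open>f\<close> keeps the edge set nonempty, so the extra one is
    available also for \<open>F = {}\<close>.\<close>
  have rank2: "k + 1 + card F \<le> dim (insert x0 B \<union> a ` F \<union> b ` F)" if "F \<subseteq> R" for F
  proof -
    let ?D = "insert x0 B \<union> a ` F \<union> b ` F"
    have "card (insert f (F \<union> (`) g ` F)) = 2 * card F + 1"
      using fR that by (subst card_insert_disjoint) (auto simp: lift_card)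
    then have "k + card F + 1 \<le> dim (B \<union> edge_vectors (insert f (F \<union> (`) g ` F)))"
      using rank[OF that, of "insert f (F \<union> (`) g ` F)"] fE(1) lift_sub[OF that] by auto
    also have "\<dots> \<le> dim ?D"
    proof (rule dim_mono)
      have "edge_vectors (insert f (F \<union> (`) g ` F)) \<subseteq> span ?D"
      proof
        fix x assume "x \<in> edge_vectors (insert f (F \<union> (`) g ` F))"
        then consider u v where "x = al u v" "{u, v} = f" | "x \<in> edge_vectors (F \<union> (`) g ` F)"
          by (auto simp: edge_vectors_def al_def)
        then show "x \<in> span ?D"
        proof cases
          case 1
          have "{u, v} = {U f, W f}" using 1(2) UW[OF fE(1)] by simp
          then have "x = x0 \<or> x = - x0"
            by (auto simp: 1(1) x0_def al_def doubleton_eq_iff)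
          moreover have "x0 \<in> span ?D" by (rule span_base) simp
          ultimately show ?thesis by (auto intro: span_neg)
        qed (use ev_sub[OF that] in blast)
      qed
      then show "B \<union> edge_vectors (insert f (F \<union> (`) g ` F)) \<subseteq> span ?D"
        using span_superset[of ?D] by blast
    qed
    finally show ?thesis by simp
  qed
  \<comment> \<open>These functionals must not vanish on the positions: \<open>x0\<close> separates
    the ends of the fixed edge, \<open>a e\<close> gives the ends of \<open>e\<close> different
    \<open>X\<close>-coordinates, and \<open>al v (g v)\<close> keeps \<open>v\<close> off the
    mirror.\<close>
  define Xs where "Xs = insert x0 (a ` R \<union> {al v (g v) | v. v \<in> V \<and> g v \<noteq> v})"
  have UWV: "U e \<in> V" "W e \<in> V" if "e \<in> E" for e using UW[OF that] E[OF that] by auto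
  have UWR: "U e \<in> V" "W e \<in> V" "g (U e) \<in> V" "g (W e) \<in> V" if "e \<in> R" for e
    using that R(1) UWV[of e] gV by auto
  have aR: "a e \<noteq> 0" if "e \<in> R" for e
  proof
    assume "a e = 0"
    have eE: "e \<in> E" using that R(1) by blast
    \<comment> \<open>Pairing with the coordinate vectors of the two ends forces \<open>g\<close> to
      fix both of them; then \<open>e\<close> would be a fixed edge.\<close>
    let ?z = "axis (U e) 1 :: real^'v"
    have e: "e = {U e, W e}" "U e \<noteq> W e" using UW[OF eE] by auto
    have "0 = a e \<bullet> ?z" by (simp add: \<open>a e = 0\<close>)
    also have "\<dots> = 1 - ((if g (U e) = U e then 1 else 0) - (if g (W e) = U e then 1 else 0))"
      using e(2) unfolding a_def inner_diff_left al_inner by (simp add: axis_def)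
    finally have gU: "g (U e) = U e" by (auto split: if_splits)
    let ?z = "axis (W e) 1 :: real^'v"
    have "0 = a e \<bullet> ?z" by (simp add: \<open>a e = 0\<close>)
    also have "\<dots> = - 1 - ((if g (U e) = W e then 1 else 0) - (if g (W e) = W e then 1 else 0))"
      using e(2) unfolding a_def inner_diff_left al_inner by (simp add: axis_def)
    finally have gW: "g (W e) = W e" by (auto split: if_splits)
    have "g ` e = e" by (subst (1 2) e(1)) (simp add: gU gW)
    then show False using that R(2) by auto
  qed
  have Xs0: "x \<noteq> 0" if "x \<in> Xs" for x
    using that aR UW[OF fE(1)] by (auto simp: Xs_def x0_def al_def axis_eq_axis)
  have XsB: "x \<bullet> y = 0" if x: "x \<in> Xs" and y: "y \<in> B" for x y
  proof -
    obtain v where v: "v \<notin> V" "y = axis v 1" using y by (auto simp: B_def)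
    have al0: "al u u' \<bullet> y = 0" if "u \<in> V" "u' \<in> V" for u u'
      using that v by (auto simp: al_inner axis_def)
    show ?thesis
      using x UWV[OF fE(1)] UWR gV by (auto simp: Xs_def x0_def a_def inner_diff_left al0)
  qed
  have rank3: "k + 1 + card F \<le> dim (insert x B \<union> a ` F \<union> b ` F)" if "F \<subseteq> R" "x \<in> Xs" for F x
  proof (cases "F = {}")
    case True
    have "dim (B \<union> {x}) = dim B + dim {x}"
      using XsB[OF that(2)] by (intro dim_orthogonal_sum) (auto simp: inner_commute)
    moreover have "dim B = k" by (simp add: B_def k_def dim_axis_image)
    moreover have "dim {x} = 1" using Xs0[OF that(2)] by (simp add: dim_insert)
    ultimately show ?thesis using True by simp
  next
    case False
    have "B \<subseteq> insert x B" by auto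
    from rank1[OF that(1) False this] show ?thesis by simp
  qed
  \<comment> \<open>One choice of \<open>c\<close> has to serve all systems: the positions with each
    \<open>x\<close> in \<open>Xs\<close> added, the symmetric velocities with the row
    \<open>x0\<close> of the fixed edge, and the antisymmetric velocities without it.\<close>
  define T where "T = (\<lambda>x. (insert x B, a, b, k + 1)) ` Xs \<union>
    {(insert x0 B, b, \<lambda>e. - a e, k + 1), (B, a, \<lambda>e. - b e, k)}"
  have neg_dim: "dim (D \<union> a ` F \<union> b ` F) = dim (D \<union> a ` F \<union> (\<lambda>e. - b e) ` F)" for D F
    and a b :: "'v set \<Rightarrow> real^'v"
  proof (rule antisym; rule dim_mono)
    let ?D = "D \<union> a ` F \<union> (\<lambda>e. - b e) ` F" and ?D' = "D \<union> a ` F \<union> b ` F"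
    have "b e \<in> span ?D" if "e \<in> F" for e
    proof -
      have "- b e \<in> span ?D" using that by (intro span_base) auto
      then have "- (- b e) \<in> span ?D" by (rule span_neg)
      then show ?thesis by simp
    qed
    then show "?D' \<subseteq> span ?D" using span_superset[of ?D] by auto
    have "- b e \<in> span ?D'" if "e \<in> F" for e using that by (intro span_neg span_base) auto
    then show "?D \<subseteq> span ?D'" using span_superset[of ?D'] by auto
  qed

  \<comment> \<open>Simultaneous choice of generic slopes\<close>
  have "\<exists>c. \<forall>(D, a, b, k)\<in>T. k + card R \<le> dim (D \<union> (\<lambda>e. a e + c e *\<^sub>R b e) ` R)"
  proof (rule generic_combination)
    show "finite T" unfolding T_def Xs_def by auto
    fix D a' b' k' F assume t: "(D, a', b', k') \<in> T" and F: "F \<subseteq> R"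
    from t consider x where "x \<in> Xs" "D = insert x B" "a' = a" "b' = b" "k' = k + 1"
      | "D = insert x0 B" "a' = b" "b' = (\<lambda>e. - a e)" "k' = k + 1"
      | "D = B" "a' = a" "b' = (\<lambda>e. - b e)" "k' = k"
      by (auto simp: T_def)
    then show "k' + card F \<le> dim (D \<union> a' ` F \<union> b' ` F)"
    proof cases
      case 1
      then show ?thesis using rank3[OF F] by simp
    next
      case 2
      have "dim (D \<union> a' ` F \<union> b' ` F) = dim (insert x0 B \<union> b ` F \<union> a ` F)"
        unfolding 2 by (rule neg_dim[symmetric])
      also have "insert x0 B \<union> b ` F \<union> a ` F = insert x0 B \<union> a ` F \<union> b ` F" by auto
      finally show ?thesis using rank2[OF F] 2(4) by simp
    next
      case 3
      have "dim (D \<union> a' ` F \<union> b' ` F) = dim (B \<union> a ` F \<union> b ` F)"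
        unfolding 3 by (rule neg_dim[symmetric])
      moreover have "k + card F \<le> dim (B \<union> a ` F \<union> b ` F)"
      proof (cases "F = {}")
        case True
        then show ?thesis by (simp add: B_def k_def dim_axis_image)
      next
        case False
        then show ?thesis using rank1[OF F False, of B] by simp
      qed
      ultimately show ?thesis using 3(4) by simp
    qed
  qed simp
  then obtain c where cT: "\<forall>(D, a, b, k)\<in>T. k + card R \<le> dim (D \<union> (\<lambda>e. a e + c e *\<^sub>R b e) ` R)" by blast
  define rP where "rP = (\<lambda>e. a e + c e *\<^sub>R b e) ` R"
  define rS where "rS = (\<lambda>e. b e + c e *\<^sub>R (- a e)) ` R"
  define rA where "rA = (\<lambda>e. a e + c e *\<^sub>R (- b e)) ` R"
  have dimP: "k + 1 + card R \<le> dim (insert x B \<union> rP)" if "x \<in> Xs" for x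
    using cT that unfolding rP_def T_def by auto
  have dimS: "k + 1 + card R \<le> dim (insert x0 B \<union> rS)" using cT unfolding rS_def T_def by auto
  have dimA: "k + card R \<le> dim (B \<union> rA)" using cT unfolding rA_def T_def by auto

  \<comment> \<open>Positions realising the slopes\<close>
  define ker where "ker D = {z :: real^'v. \<forall>x\<in>D. x \<bullet> z = 0}" for D
  \<comment> \<open>The ambient dimension is \<open>k + card R + 2\<close>. Hence
    \<open>dimP\<close> and \<open>dimS\<close> bound their kernels by dimension 1 and
    \<open>dimA\<close> by dimension 2; the last two add up to the required 3.\<close>
  have dim_ker: "dim (ker D) + dim D = k + card R + 2" for D
    using dim_orthogonal_complement[of D] kV cardR by (simp add: ker_def)
  have sub_ker: "subspace (ker D)" for D
    by (auto simp: ker_def subspace_def inner_add_right)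
  \<comment> \<open>The constant solution puts all vertices at the same point of the mirror; adding
    it is a translation along the mirror.\<close>
  define one where "one = (\<chi> v. if v \<in> V then (1::real) else 0)"
  have "card V \<noteq> 0" using cardR by simp
  then obtain v0 where "v0 \<in> V" by fastforce
  then have one0: "one \<noteq> 0" by (auto simp: one_def vec_eq_iff)
  \<comment> \<open>There are at most \<open>k + card R\<close> rows, so the kernel has dimension at
    least 2 and contains some \<open>z\<close> that is not a multiple of \<open>one\<close>.\<close>
  have "dim (B \<union> rP) \<le> k + card R"
  proof -
    have "finite (B \<union> rP)" by (simp add: B_def rP_def)
    then have "dim (B \<union> rP) \<le> card (B \<union> rP)" by (rule dim_le_card')
    also have "\<dots> \<le> card B + card rP" by (rule card_Un_le)
    also have "\<dots> \<le> k + card R"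
      unfolding B_def rP_def k_def by (intro add_mono card_image_le) auto
    finally show ?thesis .
  qed
  then have "2 \<le> dim (ker (B \<union> rP))" using dim_ker[of "B \<union> rP"] by linarith
  moreover have "dim {one} = 1" using one0 by (simp add: dim_insert)
  ultimately have "\<not> ker (B \<union> rP) \<subseteq> span {one}" using dim_mono[of "ker (B \<union> rP)" "{one}"] by auto
  then obtain z where z: "z \<in> ker (B \<union> rP)" "z \<notin> span {one}" by blast
  have Xs_one: "x \<bullet> one = 0" if "x \<in> Xs" for x
    using that UWV[OF fE(1)] UWR gV
    by (auto simp: Xs_def x0_def a_def inner_diff_left al_inner one_def)
  have one_ker: "one \<in> ker (B \<union> rP)"
    using UWR
    by (auto simp: ker_def B_def rP_def inner_add_left a_def b_def inner_diff_left al_inner one_def inner_axis')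
  \<comment> \<open>Otherwise \<open>z\<close> and \<open>one\<close> would span two dimensions
    inside a kernel of dimension at most 1.\<close>
  have Xs_z: "x \<bullet> z \<noteq> 0" if "x \<in> Xs" for x
  proof
    assume "x \<bullet> z = 0"
    then have "{z, one} \<subseteq> ker (insert x B \<union> rP)"
      using z(1) one_ker Xs_one[OF that] by (auto simp: ker_def)
    then have "dim {z, one} \<le> dim (ker (insert x B \<union> rP))" by (rule dim_subset)
    moreover have "dim {z, one} = 2" using z(2) one0 by (simp add: dim_insert)
    ultimately show False using dimP[OF that] dim_ker[of "insert x B \<union> rP"] by linarith
  qed
  define X where "X v = z $ v - z $ g v" for v
  define Y where "Y v = z $ v + z $ g v" for v
  have Xg: "X (g v) = - X v" and Yg: "Y (g v) = Y v" for v by (simp_all add: X_def Y_def gg)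
  have X0: "X v \<noteq> 0" if "v \<in> V" "g v \<noteq> v" for v
    using Xs_z[of "al v (g v)"] that by (auto simp: Xs_def al_inner X_def)
  have aX: "a e \<bullet> z = X (U e) - X (W e)" and bY: "b e \<bullet> z = Y (U e) - Y (W e)" for e
    by (simp_all add: a_def b_def inner_diff_left inner_add_left al_inner X_def Y_def)
  have XY: "X (U e) - X (W e) = - c e * (Y (U e) - Y (W e)) \<and> Y (U e) \<noteq> Y (W e)" if "e \<in> R" for e
  proof -
    have "(a e + c e *\<^sub>R b e) \<bullet> z = 0" using z(1) that by (auto simp: ker_def rP_def)
    then have 1: "X (U e) - X (W e) + c e * (Y (U e) - Y (W e)) = 0"
      by (simp add: inner_add_left aX bY)
    have "a e \<bullet> z \<noteq> 0" using that by (intro Xs_z) (simp add: Xs_def)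
    then have "X (U e) - X (W e) \<noteq> 0" by (simp add: aX)
    then show ?thesis using 1 by auto
  qed

  \<comment> \<open>Infinitesimal motions of the realisation\<close>
  let ?K = "{w :: (real^2)^'v. (\<forall>v. v \<notin> V \<longrightarrow> w $ v = 0) \<and>
      (\<forall>u v. {u, v} \<in> E \<longrightarrow>
        (X u - X v) * (w $ u $ 1 - w $ v $ 1) + (Y u - Y v) * (w $ u $ 2 - w $ v $ 2) = 0)}"
  \<comment> \<open>\<open>zS\<close> packs the symmetric part of the velocity (first component odd
    under \<open>g\<close>, second even) into one real function, and \<open>zA\<close> the
    antisymmetric part. Comparing the values at \<open>u\<close> and \<open>g u\<close> separates
    odd from even, so nothing is lost.\<close>
  define zS where "zS w = (\<chi> u. (w $ u $ 1 - w $ g u $ 1) + (w $ u $ 2 + w $ g u $ 2))" for w :: "(real^2)^'v"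
  define zA where "zA w = (\<chi> u. (w $ u $ 1 + w $ g u $ 1) + (w $ u $ 2 - w $ g u $ 2))" for w :: "(real^2)^'v"
  have "dim ?K \<le> dim (ker (insert x0 B \<union> rS) \<times> ker (B \<union> rA))"
  proof (rule dim_le_dim_linear_inj[where f = "\<lambda>w. (zS w, zA w)"])
    show "linear (\<lambda>w. (zS w, zA w))"
      by (rule linearI) (auto simp: zS_def zA_def vec_eq_iff algebra_simps)
    show "subspace ?K"
    proof -
      define q where "q u v w = (X u - X v) * (w $ u $ 1 - w $ v $ 1) + (Y u - Y v) * (w $ u $ 2 - w $ v $ 2)"
        for u v and w :: "(real^2)^'v"
      have "q u v (x + y) = q u v x + q u v y" "q u v (r *\<^sub>R x) = r * q u v x" "q u v 0 = 0" for u v x y r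
        by (simp_all add: q_def algebra_simps)
      then show ?thesis unfolding q_def[symmetric] by (auto simp: subspace_def)
    qed
    fix w assume w: "w \<in> ?K" "(zS w, zA w) = 0"
    have 1: "w $ u $ 1 - w $ g u $ 1 + (w $ u $ 2 + w $ g u $ 2) = 0" for u
      using w(2) by (auto simp: zS_def zero_prod_def vec_eq_iff)
    have 2: "w $ u $ 1 + w $ g u $ 1 + (w $ u $ 2 - w $ g u $ 2) = 0" for u
      using w(2) by (auto simp: zA_def zero_prod_def vec_eq_iff)
    have "w $ u $ 1 = 0 \<and> w $ u $ 2 = 0" for u
      using 1[of u] 1[of "g u"] 2[of u] 2[of "g u"] unfolding gg by linarith
    then show "w = 0" by (simp add: vec_eq_iff forall_2)
  next
    show "(\<lambda>w. (zS w, zA w)) ` ?K \<subseteq> ker (insert x0 B \<union> rS) \<times> ker (B \<union> rA)"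
    proof
      fix y assume "y \<in> (\<lambda>w. (zS w, zA w)) ` ?K"
      then obtain w where y: "y = (zS w, zA w)" and w0: "\<And>v. v \<notin> V \<Longrightarrow> w $ v = 0"
        and wE: "\<And>u v. {u, v} \<in> E \<Longrightarrow>
          (X u - X v) * (w $ u $ 1 - w $ v $ 1) + (Y u - Y v) * (w $ u $ 2 - w $ v $ 2) = 0"
        by auto
      have offV: "g v \<notin> V" if "v \<notin> V" for v using gV[of "g v"] that by (auto simp: gg)
      have BS: "x \<bullet> zS w = 0" "x \<bullet> zA w = 0" if "x \<in> B" for x
        using that offV w0 by (auto simp: B_def inner_axis' zS_def zA_def)
      \<comment> \<open>The position equation turns the \<open>X\<close>-difference into a multiple
        of the \<open>Y\<close>-difference, which is nonzero and cancels. What remains is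
        \<open>dy = c e * dx\<close> on \<open>e\<close> and \<open>dy' = - c e * dx'\<close> on its
        mirror image; both rows are combinations of these.\<close>
      have row: "(b e + c e *\<^sub>R (- a e)) \<bullet> zS w = 0 \<and> (a e + c e *\<^sub>R (- b e)) \<bullet> zA w = 0"
        if "e \<in> R" for e
      proof -
        define u v where "u = U e" and "v = W e"
        have eE: "e \<in> E" using that R(1) by blast
        then have e: "{u, v} \<in> E" using UW u_def v_def by metis
        have ge: "{g u, g v} \<in> E" using gE[OF e] by simp
        define dx dy dx' dy' where "dx = w $ u $ 1 - w $ v $ 1" and "dy = w $ u $ 2 - w $ v $ 2"
          and "dx' = w $ g u $ 1 - w $ g v $ 1" and "dy' = w $ g u $ 2 - w $ g v $ 2"
        have XYe: "X u - X v = - c e * (Y u - Y v)" "Y u - Y v \<noteq> 0"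
          using XY[OF that] by (auto simp: u_def v_def)
        have "(X u - X v) * dx + (Y u - Y v) * dy = 0" using wE[OF e] by (simp add: dx_def dy_def)
        then have "(Y u - Y v) * (dy - c e * dx) = 0" unfolding XYe(1) by (simp add: algebra_simps)
        then have 1: "dy = c e * dx" using XYe(2) by simp
        have "- (X u - X v) * dx' + (Y u - Y v) * dy' = 0"
          using wE[OF ge] by (simp add: dx'_def dy'_def Xg Yg algebra_simps)
        then have "(Y u - Y v) * (dy' + c e * dx') = 0" unfolding XYe(1) by (simp add: algebra_simps)
        then have 2: "dy' = - c e * dx'" using XYe(2) by simp
        have in4: "b e \<bullet> zS w = 2 * (dy + dy')" "a e \<bullet> zS w = 2 * (dx - dx')"
          "b e \<bullet> zA w = 2 * (dx + dx')" "a e \<bullet> zA w = 2 * (dy - dy')"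
          by (simp_all add: a_def b_def inner_add_left inner_diff_left al_inner zS_def zA_def gg
              dx_def dy_def dx'_def dy'_def u_def v_def)
        show ?thesis
          unfolding inner_add_left inner_scaleR_left inner_minus_left in4 1 2
          by (simp add: algebra_simps)
      qed
      have "x0 \<bullet> zS w = 0"
      proof -
        define u v where "u = U f" and "v = W f"
        have f: "f = {u, v}" "u \<noteq> v" using UW[OF fE(1)] by (auto simp: u_def v_def)
        have z0: "z $ u - z $ v \<noteq> 0"
          using Xs_z[of x0] by (simp add: Xs_def x0_def al_inner u_def v_def)
        have eq: "(X u - X v) * (w $ u $ 1 - w $ v $ 1) + (Y u - Y v) * (w $ u $ 2 - w $ v $ 2) = 0"
          using wE fE(1) f(1) by blast
        have "{g u, g v} = {u, v}" using fE(2) f(1) by simp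
        \<comment> \<open>If \<open>g\<close> fixes both ends, they lie on the mirror and only
          \<open>Y\<close> differs; if \<open>g\<close> swaps them, only \<open>X\<close> differs.
          By \<open>z0\<close> the remaining difference is nonzero and cancels.\<close>
        then consider "g u = u" "g v = v" | "g u = v" "g v = u" by (metis doubleton_eq_iff)
        then have "zS w $ u - zS w $ v = 0"
          by cases (use eq z0 in \<open>auto simp: zS_def X_def Y_def\<close>)
        then show ?thesis by (simp add: x0_def al_inner u_def v_def)
      qed
      then show "y \<in> ker (insert x0 B \<union> rS) \<times> ker (B \<union> rA)"
        using row BS by (auto simp: y ker_def rS_def rA_def)
    qed
  qed
  also have "\<dots> = dim (ker (insert x0 B \<union> rS)) + dim (ker (B \<union> rA))"
    by (intro dim_Times sub_ker)
  also have "\<dots> \<le> 3"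
    using dim_ker[of "insert x0 B \<union> rS"] dim_ker[of "B \<union> rA"] dimS dimA by linarith
  finally have dimK: "dim ?K \<le> 3" .
  have Yne: "Y u \<noteq> Y v" if "{u, v} \<in> E" "g ` {u, v} \<noteq> {u, v}" for u v
  proof -
    have "{u, v} \<in> R \<union> (`) g ` R"
      using subsetD[OF equalityD1[OF R(4)] that(1)] that(2) by simp
    then obtain e where e: "e \<in> R" "{u, v} = e \<or> {u, v} = g ` e" by auto
    have eE: "e = {U e, W e}" using UW R(1) e(1) by blast
    have "g ` {U e, W e} = {g (U e), g (W e)}" by simp
    then have "{u, v} = {U e, W e} \<or> {u, v} = {g (U e), g (W e)}"
      using e(2) eE by metis
    then show ?thesis using XY[OF e(1)] by (auto simp: doubleton_eq_iff Yg)
  qed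
  show ?thesis
  proof (rule that)
    show "\<forall>v. X (g v) = - X v" "\<forall>v. Y (g v) = Y v" by (simp_all add: Xg Yg)
    show "\<forall>v\<in>V. g v \<noteq> v \<longrightarrow> X v \<noteq> 0" using X0 by simp
    show "\<forall>u v. {u, v} \<in> E \<longrightarrow> g ` {u, v} \<noteq> {u, v} \<longrightarrow> Y u \<noteq> Y v" using Yne by simp
  qed (fact dimK)
qed

section \<open>Motions of point-line frameworks\<close>

definition rot90 :: "real^2 \<Rightarrow> real^2" where
  "rot90 x = vector [- (x $ 2), x $ 1]"

lemma rot90_components [simp]: "rot90 x $ 1 = - (x $ 2)" "rot90 x $ 2 = x $ 1"
  by (simp_all add: rot90_def)

lemma inner_real2: "x \<bullet> y = x $ 1 * y $ 1 + x $ 2 * y $ 2" for x y :: "real^2"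
  by (simp add: inner_vec_def sum_2)

lemma eq_real2_iff: "x = y \<longleftrightarrow> x $ 1 = y $ 1 \<and> x $ 2 = y $ 2" for x y :: "real^2"
  by (simp add: vec_eq_iff forall_2)

lemma norm_eq_1_real2: "norm x = 1 \<longleftrightarrow> x $ 1 * x $ 1 + x $ 2 * x $ 2 = 1" for x :: "real^2"
  by (simp add: norm_eq_1 inner_real2)

text \<open>
  The tangential constraint on normals is solved by \<open>da j = w j $ 1 *\<^sub>R rot90 (a j)\<close>, so that a
  vector in \<open>(real^2)^'v\<close> encodes the velocity of each point and the pair of angular velocity and
  \<open>dr\<close> of each line.
\<close>

definition edge_form ::
  "'v set \<Rightarrow> ('v \<Rightarrow> real^2) \<Rightarrow> ('v \<Rightarrow> real^2) \<Rightarrow> 'v \<Rightarrow> 'v \<Rightarrow> (real^2)^'v::finite \<Rightarrow> real" where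
  "edge_form VP p a u v w =
     (if u \<in> VP then
        if v \<in> VP then (p u - p v) \<bullet> (w $ u - w $ v)
        else w $ v $ 1 * (p u \<bullet> rot90 (a v)) + w $ u \<bullet> a v + w $ v $ 2
      else
        if v \<in> VP then w $ u $ 1 * (p v \<bullet> rot90 (a u)) + w $ v \<bullet> a u + w $ u $ 2
        else (a u \<bullet> rot90 (a v)) * (w $ v $ 1 - w $ u $ 1))"

text \<open>Edges are unordered; the choice of the first end is harmless because
  \<open>edge_form\<close> is symmetric in its ends.\<close>

definition edge_functional ::
  "'v set \<Rightarrow> ('v \<Rightarrow> real^2) \<Rightarrow> ('v \<Rightarrow> real^2) \<Rightarrow> 'v set \<Rightarrow> (real^2)^'v::finite \<Rightarrow> real" where
  "edge_functional VP p a e =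
     (let u = (SOME u. \<exists>v. e = {u, v}) in edge_form VP p a u (other_end e u))"

definition supported_on :: "'v set \<Rightarrow> ((real^2)^'v::finite) set" where
  "supported_on V = {w. \<forall>v. v \<notin> V \<longrightarrow> w $ v = 0}"

text \<open>Infinitesimal motions in the encoding by \<open>w\<close>. The vertex set is an argument
  of its own because subgraphs on fewer vertices are counted as well.\<close>

definition flexes ::
  "'v set \<Rightarrow> 'v set \<Rightarrow> 'v set set \<Rightarrow> ('v \<Rightarrow> real^2) \<Rightarrow> ('v \<Rightarrow> real^2) \<Rightarrow> ((real^2)^'v::finite) set" where
  "flexes VP V E p a = {w \<in> supported_on V. \<forall>e\<in>E. edge_functional VP p a e w = 0}"

lemma edge_form_commute: "edge_form VP p a u v w = edge_form VP p a v u w"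
  by (simp add: edge_form_def inner_real2 algebra_simps)

lemma edge_functional_pair: "edge_functional VP p a {u, v} = edge_form VP p a u v"
proof -
  define x where "x = (SOME x. \<exists>y. {u, v} = {x, y})"
  have "\<exists>y. {u, v} = {x, y}" unfolding x_def by (rule someI_ex) blast
  then consider "x = u" | "x = v" by (auto simp: doubleton_eq_iff)
  then show ?thesis
    unfolding edge_functional_def x_def[symmetric] Let_def
    by cases (auto simp: other_end_simps edge_form_commute)
qed

lemma linear_edge_functional: "linear (edge_functional VP p a e)"
proof -
  have "linear (edge_form VP p a u v)" for u v
    by (rule linearI) (auto simp: edge_form_def inner_real2 algebra_simps)
  then show ?thesis by (simp add: edge_functional_def Let_def)
qed

lemma subspace_supported_on: "subspace (supported_on V)"
  by (auto simp: supported_on_def subspace_def)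

lemma dim_supported_on:
  fixes V :: "'v::finite set"
  shows "dim (supported_on V) = 2 * card V"
proof -
  define d where "d = (\<lambda>(v, b). axis v b :: (real^2)^'v) ` (V \<times> Basis)"
  have d: "d \<subseteq> Basis" by (auto simp: d_def axis_in_Basis_iff)
  have "supported_on V = {x. \<forall>i\<in>Basis. i \<notin> d \<longrightarrow> x \<bullet> i = 0}"
  proof (intro equalityI subsetI)
    fix x :: "(real^2)^'v" assume "x \<in> supported_on V"
    then show "x \<in> {x. \<forall>i\<in>Basis. i \<notin> d \<longrightarrow> x \<bullet> i = 0}"
      by (auto simp: supported_on_def d_def Basis_vec_def inner_axis image_iff)
  next
    fix x :: "(real^2)^'v" assume x: "x \<in> {x. \<forall>i\<in>Basis. i \<notin> d \<longrightarrow> x \<bullet> i = 0}"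
    have "x $ v = 0" if v: "v \<notin> V" for v
    proof (rule euclidean_eqI)
      fix b :: "real^2" assume b: "b \<in> Basis"
      have "axis v b \<notin> d" using v b by (auto simp: d_def axis_eq_axis)
      then have "x \<bullet> axis v b = 0" using x b by (auto simp: axis_in_Basis_iff)
      then show "x $ v \<bullet> b = 0 \<bullet> b" by (simp add: inner_axis)
    qed
    then show "x \<in> supported_on V" by (simp add: supported_on_def)
  qed
  moreover have "card d = 2 * card V"
  proof -
    have "inj_on (\<lambda>(v, b). axis v b :: (real^2)^'v) (V \<times> Basis)"
      by (auto simp: inj_on_def axis_eq_axis)
    then have "card d = card (V \<times> (Basis :: (real^2) set))" unfolding d_def by (rule card_image)
    then show ?thesis by (simp add: card_cartesian_product)
  qed
  ultimately show ?thesis using dim_substandard[OF d] by simp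
qed

lemma dim_flexes_ge:
  fixes E :: "'v::finite set set"
  shows "2 * card V \<le> dim (flexes VP V E p a) + card E"
  unfolding flexes_def dim_supported_on[symmetric]
  by (intro dim_le_dim_common_kernel subspace_supported_on linear_edge_functional) simp

lemma subspace_flexes: "subspace (flexes VP V E p a)"
  unfolding flexes_def by (intro subspace_common_kernel subspace_supported_on linear_edge_functional)

text \<open>The map \<open>\<Phi>\<close> decodes \<open>w\<close>. It is onto because a vector
  orthogonal to a unit normal is a multiple of its \<open>rot90\<close>, and injective because this
  \<open>rot90\<close> is nonzero.\<close>

lemma dim_infinitesimal_motions:
  fixes E :: "'v::finite set set"
  assumes G: "point_line_graph VP VH E" and unit: "\<And>j. j \<in> VH \<Longrightarrow> norm (fst (L j)) = 1"
  shows "dim (infinitesimal_motions VP VH E p L) = dim (flexes VP (VP \<union> VH) E p (\<lambda>j. fst (L j)))"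
proof -
  let ?a = "\<lambda>j. fst (L j)"
  define \<Phi> :: "(real^2)^'v \<Rightarrow> ((real^2)^'v) \<times> ((real^2)^'v) \<times> (real^'v)" where
    "\<Phi> w = (\<chi> i. if i \<in> VP then w $ i else 0, \<chi> j. if j \<in> VH then w $ j $ 1 *\<^sub>R rot90 (?a j) else 0,
      \<chi> j. if j \<in> VH then w $ j $ 2 else 0)" for w
  have disj: "\<And>i. i \<in> VP \<Longrightarrow> i \<notin> VH" using G by (auto simp: point_line_graph_def)
  have lin: "linear \<Phi>"
    by (rule linearI) (auto simp: \<Phi>_def vec_eq_iff algebra_simps)
  have unit': "?a j $ 1 * ?a j $ 1 + ?a j $ 2 * ?a j $ 2 = 1" if "j \<in> VH" for j
    using unit[OF that] by (simp add: norm_eq_1_real2)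
  have inj: "w = 0" if "w \<in> flexes VP (VP \<union> VH) E p ?a" "\<Phi> w = 0" for w
  proof -
    have \<Phi>0: "fst (\<Phi> w) $ v = 0" "fst (snd (\<Phi> w)) $ v = 0" "snd (snd (\<Phi> w)) $ v = 0" for v
      using that(2) by simp_all
    have "w $ v = 0" for v
    proof -
      have "w $ v = 0" if "v \<in> VP"
        using \<Phi>0[of v] that by (simp add: \<Phi>_def)
      moreover have "w $ v = 0" if v: "v \<in> VH"
      proof -
        have "rot90 (?a v) \<noteq> 0" using unit'[OF v] by (auto simp: eq_real2_iff)
        moreover have "w $ v $ 1 *\<^sub>R rot90 (?a v) = 0" "w $ v $ 2 = 0"
          using \<Phi>0[of v] v by (simp_all add: \<Phi>_def)
        ultimately show ?thesis by (auto simp: eq_real2_iff)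
      qed
      ultimately show ?thesis using that(1) by (auto simp: flexes_def supported_on_def)
    qed
    then show ?thesis by (simp add: vec_eq_iff)
  qed
  have edge: "\<exists>i j. e = {i, j} \<and>
      (i \<in> VP \<and> j \<in> VP \<or> i \<in> VP \<and> j \<in> VH \<or> i \<in> VH \<and> j \<in> VH)" if "e \<in> E" for e
  proof -
    have "card e = 2" "e \<subseteq> VP \<union> VH" using that G by (auto simp: point_line_graph_def)
    then obtain i j where "e = {i, j}" "i \<in> VP \<union> VH" "j \<in> VP \<union> VH"
      by (auto simp: card_2_iff)
    moreover have "{i, j} = {j, i}" by (rule insert_commute)
    ultimately show ?thesis by blast
  qed
  have motion_iff: "\<Phi> w \<in> infinitesimal_motions VP VH E p L \<longleftrightarrow> w \<in> flexes VP (VP \<union> VH) E p ?a"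
    if w: "w \<in> supported_on (VP \<union> VH)" for w
  proof -
    have "(\<forall>e\<in>E. edge_functional VP p ?a e w = 0) \<longleftrightarrow>
      (\<forall>i\<in>VP. \<forall>j\<in>VP. {i, j} \<in> E \<longrightarrow> edge_form VP p ?a i j w = 0) \<and>
      (\<forall>i\<in>VP. \<forall>j\<in>VH. {i, j} \<in> E \<longrightarrow> edge_form VP p ?a i j w = 0) \<and>
      (\<forall>i\<in>VH. \<forall>j\<in>VH. {i, j} \<in> E \<longrightarrow> edge_form VP p ?a i j w = 0)" (is "?L \<longleftrightarrow> ?R")
    proof
      assume ?L
      then show ?R unfolding edge_functional_pair[symmetric] by blast
    next
      assume R: ?R
      show ?L
      proof
        fix e assume "e \<in> E"
        with edge[OF this] obtain i j where "e = {i, j}" "{i, j} \<in> E"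
          "i \<in> VP \<and> j \<in> VP \<or> i \<in> VP \<and> j \<in> VH \<or> i \<in> VH \<and> j \<in> VH" by blast
        then show "edge_functional VP p ?a e w = 0" using R by (auto simp: edge_functional_pair)
      qed
    qed
    moreover have "(\<forall>i\<in>VP. \<forall>j\<in>VP. {i, j} \<in> E \<longrightarrow> edge_form VP p ?a i j w = 0) \<longleftrightarrow>
      (\<forall>i\<in>VP. \<forall>j\<in>VP. {i, j} \<in> E \<longrightarrow> (p i - p j) \<bullet> (fst (\<Phi> w) $ i - fst (\<Phi> w) $ j) = 0)"
      by (auto simp: edge_form_def \<Phi>_def)
    moreover have "(\<forall>i\<in>VP. \<forall>j\<in>VH. {i, j} \<in> E \<longrightarrow> edge_form VP p ?a i j w = 0) \<longleftrightarrow>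
      (\<forall>i\<in>VP. \<forall>j\<in>VH. {i, j} \<in> E \<longrightarrow>
         p i \<bullet> (fst (snd (\<Phi> w)) $ j) + (fst (\<Phi> w) $ i) \<bullet> fst (L j) + snd (snd (\<Phi> w)) $ j = 0)"
      using disj by (intro ball_cong refl) (auto simp: edge_form_def \<Phi>_def)
    moreover have "(\<forall>i\<in>VH. \<forall>j\<in>VH. {i, j} \<in> E \<longrightarrow> edge_form VP p ?a i j w = 0) \<longleftrightarrow>
      (\<forall>i\<in>VH. \<forall>j\<in>VH. {i, j} \<in> E \<longrightarrow>
         fst (L i) \<bullet> (fst (snd (\<Phi> w)) $ j) + (fst (snd (\<Phi> w)) $ i) \<bullet> fst (L j) = 0)"
    proof (intro ball_cong refl)
      fix i j assume ij: "i \<in> VH" "j \<in> VH"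
      then have "i \<notin> VP" "j \<notin> VP" using disj by auto
      then have "edge_form VP p ?a i j w =
        fst (L i) \<bullet> (fst (snd (\<Phi> w)) $ j) + (fst (snd (\<Phi> w)) $ i) \<bullet> fst (L j)"
        using ij by (simp add: edge_form_def \<Phi>_def inner_real2 algebra_simps)
      then show "({i, j} \<in> E \<longrightarrow> edge_form VP p ?a i j w = 0) \<longleftrightarrow> ({i, j} \<in> E \<longrightarrow>
         fst (L i) \<bullet> (fst (snd (\<Phi> w)) $ j) + (fst (snd (\<Phi> w)) $ i) \<bullet> fst (L j) = 0)" by simp
    qed
    moreover have "\<forall>i\<in>VH. fst (L i) \<bullet> (fst (snd (\<Phi> w)) $ i) = 0"
      by (auto simp: \<Phi>_def inner_real2)
    moreover have "velocity_supported VP VH (fst (\<Phi> w)) (fst (snd (\<Phi> w))) (snd (snd (\<Phi> w)))"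
      by (auto simp: \<Phi>_def velocity_supported_def)
    ultimately show ?thesis
      using w unfolding infinitesimal_motions_def flexes_def by (auto simp: case_prod_beta)
  qed
  have "infinitesimal_motions VP VH E p L = \<Phi> ` flexes VP (VP \<union> VH) E p ?a"
  proof (intro equalityI subsetI)
    fix t assume t: "t \<in> infinitesimal_motions VP VH E p L"
    obtain dp da dr where t3: "t = (dp, da, dr)" by (cases t)
    have supp: "velocity_supported VP VH dp da dr" and tan: "\<And>j. j \<in> VH \<Longrightarrow> ?a j \<bullet> (da $ j) = 0"
      using t unfolding t3 infinitesimal_motions_def by auto
    define w :: "(real^2)^'v" where "w = (\<chi> v. if v \<in> VP then dp $ v else
      if v \<in> VH then vector [da $ v \<bullet> rot90 (?a v), dr $ v] else 0)"
    have "da $ j = (da $ j \<bullet> rot90 (?a j)) *\<^sub>R rot90 (?a j)" if j: "j \<in> VH" for j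
    proof -
      let ?x = "?a j $ 1" and ?y = "?a j $ 2" and ?d = "da $ j $ 1" and ?d' = "da $ j $ 2"
      have 1: "?x * ?x + ?y * ?y = 1" using unit'[OF j] .
      have 2: "?x * ?d + ?y * ?d' = 0" using tan[OF j] by (simp add: inner_real2)
      have "?d = (?x * ?x + ?y * ?y) * ?d - ?x * (?x * ?d + ?y * ?d')" unfolding 1 2 by simp
      moreover have "?d' = (?x * ?x + ?y * ?y) * ?d' - ?y * (?x * ?d + ?y * ?d')" unfolding 1 2 by simp
      ultimately show ?thesis by (simp add: eq_real2_iff inner_real2 algebra_simps)
    qed
    then have "\<Phi> w = t"
      using supp disj by (auto simp: \<Phi>_def t3 w_def velocity_supported_def vec_eq_iff)
    moreover have "w \<in> supported_on (VP \<union> VH)" by (auto simp: w_def supported_on_def)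
    ultimately show "t \<in> \<Phi> ` flexes VP (VP \<union> VH) E p ?a" using motion_iff t by blast
  next
    fix t assume "t \<in> \<Phi> ` flexes VP (VP \<union> VH) E p ?a"
    then show "t \<in> infinitesimal_motions VP VH E p L"
      using motion_iff by (auto simp: flexes_def)
  qed
  then show ?thesis using dim_image_subspace[OF lin subspace_flexes inj] by simp
qed

text \<open>
  The velocities that are zero on the vertex set lie in the kernel of the rigidity matrix for every
  realisation, so the kernel exceeds the space of infinitesimal motions by a constant dimension.
\<close>

lemma dim_motions_antimono_rank:
  fixes E :: "'v::finite set set"
  assumes G: "point_line_graph VP VH E"
    and rank: "rank (rigidity_matrix VP VH E p' L') \<le> rank (rigidity_matrix VP VH E p L)"
  shows "dim (infinitesimal_motions VP VH E p L) \<le> dim (infinitesimal_motions VP VH E p' L')"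
proof -
  define vv :: "((real^2)^'v) \<times> ((real^2)^'v) \<times> (real^'v) \<Rightarrow> _" where
    "vv t = velocity_vector (fst t) (fst (snd t)) (snd (snd t))" for t
  define N :: "(((real^2)^'v) \<times> ((real^2)^'v) \<times> (real^'v)) set" where
    "N = {t. (\<forall>i\<in>VP. fst t $ i = 0) \<and> (\<forall>j\<in>VH. fst (snd t) $ j = 0 \<and> snd (snd t) $ j = 0)}"
  have linvv: "linear vv"
    by (rule linearI) (auto simp: vv_def velocity_vector_def vec_eq_iff split: sum.splits prod.splits)
  have injvv: "t = 0" if "vv t = 0" for t
  proof -
    have c: "vv t $ c = 0" for c using that by simp
    have "fst t = 0" using c[of "Inl (_, _)"] by (simp add: vv_def velocity_vector_def vec_eq_iff)
    moreover have "fst (snd t) = 0"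
      using c[of "Inr (Inl (_, _))"] by (simp add: vv_def velocity_vector_def vec_eq_iff)
    moreover have "snd (snd t) = 0"
      using c[of "Inr (Inr _)"] by (simp add: vv_def velocity_vector_def vec_eq_iff)
    ultimately show ?thesis by (simp add: prod_eq_iff)
  qed
  have surjvv: "\<exists>t. vv t = x" for x
  proof (rule exI)
    show "vv (\<chi> i. \<chi> k. x $ Inl (i, k), \<chi> j. \<chi> k. x $ Inr (Inl (j, k)), \<chi> j. x $ Inr (Inr j)) = x"
      by (auto simp: vv_def velocity_vector_def vec_eq_iff split: sum.splits prod.splits)
  qed
  have key: "dim (infinitesimal_motions VP VH E p L) + dim N + rank (rigidity_matrix VP VH E p L) =
      CARD(('v \<times> 2) + ('v \<times> 2) + 'v)" for p :: "'v \<Rightarrow> real^2" and L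
  proof -
    let ?M = "rigidity_matrix VP VH E p L" and ?I = "infinitesimal_motions VP VH E p L"
    define K where "K = {t. ?M *v vv t = 0}"
    have subK: "subspace K" unfolding K_def
      by (auto simp: subspace_def linear_0[OF linvv] linear_add[OF linvv] linear_cmul[OF linvv]
          matrix_vector_right_distrib matrix_vector_mult_scaleR)
    have subN: "subspace N" by (auto simp: N_def subspace_def)
    have "N \<subseteq> K"
    proof
      fix t assume "t \<in> N"
      then have "coeff_p VP VH E p L \<rho> i \<bullet> fst t $ i = 0" "coeff_a VP VH E p L \<rho> i \<bullet> fst (snd t) $ i = 0"
        "coeff_r VP VH E \<rho> i * snd (snd t) $ i = 0" for \<rho> i
        by (auto simp: N_def coeff_p_def coeff_a_def coeff_r_def split: sum.splits)
      then have "rigidity_matrix VP VH E p L *v vv t = 0"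
        unfolding vv_def vec_eq_iff rigidity_matrix_row by (simp only: sum.neutral_const) simp
      then show "t \<in> K" by (simp add: K_def)
    qed
    have I: "?I = {t \<in> K. velocity_supported VP VH (fst t) (fst (snd t)) (snd (snd t))}"
      using infinitesimal_motions_iff_rigidity_matrix[OF G]
      by (auto simp: K_def vv_def)
    have subI: "subspace ?I"
      unfolding I using subK by (auto simp: subspace_def velocity_supported_def)
    have "K = {x + y | x y. x \<in> ?I \<and> y \<in> N}"
    proof (intro equalityI subsetI)
      fix t assume t: "t \<in> K"
      define y where "y = ((\<chi> i. if i \<in> VP then 0 else fst t $ i), (\<chi> j. if j \<in> VH then 0 else fst (snd t) $ j),
        (\<chi> j. if j \<in> VH then 0 else snd (snd t) $ j))"
      have y: "y \<in> N" by (auto simp: N_def y_def)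
      then have "t - y \<in> K" using t \<open>N \<subseteq> K\<close> subK by (auto intro: subspace_diff)
      then have "t - y \<in> ?I" unfolding I by (auto simp: y_def velocity_supported_def)
      with y show "t \<in> {x + y | x y. x \<in> ?I \<and> y \<in> N}"
        by (intro CollectI exI[of _ "t - y"] exI[of _ y]) auto
    next
      fix t assume "t \<in> {x + y | x y. x \<in> ?I \<and> y \<in> N}"
      then obtain x y where "t = x + y" "x \<in> ?I" "y \<in> N" by blast
      moreover from this have "x \<in> K" "y \<in> K" using \<open>N \<subseteq> K\<close> by (auto simp: I)
      ultimately show "t \<in> K" using subspace_add[OF subK] by simp
    qed
    moreover have "?I \<inter> N = {0}"
    proof -
      have "t = 0" if "t \<in> ?I" "t \<in> N" for t
      proof -
        have "velocity_supported VP VH (fst t) (fst (snd t)) (snd (snd t))" using that(1) unfolding I by simp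
        then show ?thesis using that(2)
          by (auto simp: N_def velocity_supported_def prod_eq_iff vec_eq_iff)
      qed
      then show ?thesis using subspace_0[OF subI] subspace_0[OF subN] by blast
    qed
    ultimately have "dim K = dim ?I + dim N" using dim_sums_Int[OF subI subN] by simp
    moreover have "dim (vv ` K) = dim K"
      by (rule dim_image_subspace[OF linvv subK injvv])
    moreover have "vv ` K = {x. \<forall>r\<in>rows ?M. r \<bullet> x = 0}"
    proof -
      have "vv ` K = {x. ?M *v x = 0}"
      proof (intro equalityI subsetI)
        fix x assume x: "x \<in> {x. ?M *v x = 0}"
        obtain t where "vv t = x" using surjvv by blast
        then show "x \<in> vv ` K" using x by (auto simp: K_def)
      qed (auto simp: K_def)
      also have "\<dots> = {x. \<forall>r\<in>rows ?M. r \<bullet> x = 0}"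
      proof -
        have "rows ?M = range (($) ?M)" by (auto simp: rows_def row_def)
        moreover have "?M *v x = 0 \<longleftrightarrow> (\<forall>i. ?M $ i \<bullet> x = 0)" for x
          by (simp add: vec_eq_iff matrix_vector_mul_component)
        ultimately show ?thesis by simp
      qed
      finally show ?thesis .
    qed
    moreover have "rank ?M = dim (rows ?M)" by (rule row_rank_def)
    ultimately show ?thesis using dim_orthogonal_complement[of "rows ?M"] by simp
  qed
  show ?thesis using key[of p L] key[of p' L'] rank by linarith
qed

section \<open>Rigid motions and independence of the edge equations\<close>

lemma edge_functional_cong:
  assumes "card e = 2" "\<And>v. v \<in> e \<Longrightarrow> w $ v = w' $ v"
  shows "edge_functional VP p a e w = edge_functional VP p a e w'"
proof -
  obtain u v where e: "e = {u, v}" using assms(1) by (meson card_2_iff)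
  then have "w $ u = w' $ u" "w $ v = w' $ v" using assms(2) by auto
  then show ?thesis unfolding e edge_functional_pair by (simp add: edge_form_def)
qed

text \<open>The rigid motion with translation \<open>fst t\<close> and angular velocity
  \<open>snd t\<close> about the origin. A rotation about the origin leaves the offset of a line
  unchanged, so only the translation enters its second component.\<close>

definition rigid_velocity ::
  "'v set \<Rightarrow> 'v set \<Rightarrow> ('v \<Rightarrow> real^2) \<Rightarrow> ('v \<Rightarrow> real^2) \<Rightarrow> (real^2) \<times> real \<Rightarrow> (real^2)^'v::finite" where
  "rigid_velocity VP V p a t = (\<chi> v. if v \<in> V then
     if v \<in> VP then fst t + snd t *\<^sub>R rot90 (p v) else vector [snd t, - (fst t \<bullet> a v)]
     else 0)"

lemma linear_rigid_velocity: "linear (rigid_velocity VP V p a)"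
  by (rule linearI) (auto simp: rigid_velocity_def vec_eq_iff forall_2 inner_real2 algebra_simps)

lemma rigid_velocity_in_flexes:
  assumes "\<And>e. e \<in> E \<Longrightarrow> e \<subseteq> V \<and> card e = 2"
  shows "rigid_velocity VP V p a t \<in> flexes VP V E p a"
proof -
  have "edge_functional VP p a e (rigid_velocity VP V p a t) = 0" if eE: "e \<in> E" for e
  proof -
    obtain u v where e: "e = {u, v}" using assms[OF eE] by (meson card_2_iff)
    then have "u \<in> V" "v \<in> V" using assms[OF eE] by auto
    then show ?thesis
      unfolding e edge_functional_pair
      by (simp add: edge_form_def rigid_velocity_def inner_real2 algebra_simps)
  qed
  then show ?thesis by (auto simp: flexes_def supported_on_def rigid_velocity_def)
qed

text \<open>A nonzero functional excludes coincident points and parallel lines. A rotation cannot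
  fix two distinct points, a line at rest excludes rotation, and two independent normals exclude
  translation.\<close>

lemma rigid_velocity_eq_0_imp:
  assumes "e \<subseteq> V" "card e = 2" "edge_functional VP p a e w \<noteq> 0" "rigid_velocity VP V p a t = 0"
  shows "t = 0"
proof -
  obtain u v where e: "e = {u, v}" using assms(2) by (meson card_2_iff)
  have V: "u \<in> V" "v \<in> V" using assms(1) e by auto
  have form: "edge_form VP p a u v w \<noteq> 0" using assms(3) by (simp add: e edge_functional_pair)
  have 0: "rigid_velocity VP V p a t $ x = 0" for x using assms(4) by simp
  obtain d r where t: "t = (d, r)" by (cases t)
  have P: "d + r *\<^sub>R rot90 (p x) = 0" if "x \<in> V" "x \<in> VP" for x
    using 0[of x] that by (simp add: rigid_velocity_def t)
  have H: "r = 0 \<and> d \<bullet> a x = 0" if "x \<in> V" "x \<notin> VP" for x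
    using 0[of x] that by (simp add: rigid_velocity_def t eq_real2_iff)
  have "r = 0 \<and> d = 0"
  proof (cases "u \<in> VP"; cases "v \<in> VP")
    assume uv: "u \<in> VP" "v \<in> VP"
    have "p u \<noteq> p v" using form uv by (auto simp: edge_form_def)
    moreover have "r *\<^sub>R (rot90 (p u) - rot90 (p v)) = 0"
      using P[OF V(1) uv(1)] P[OF V(2) uv(2)] by (simp add: algebra_simps add_eq_0_iff)
    ultimately have "r = 0" by (auto simp: eq_real2_iff)
    then show ?thesis using P[OF V(1) uv(1)] by simp
  next
    assume uv: "u \<in> VP" "v \<notin> VP"
    then show ?thesis using P[OF V(1)] H[OF V(2)] by simp
  next
    assume uv: "u \<notin> VP" "v \<in> VP"
    then show ?thesis using P[OF V(2)] H[OF V(1)] by simp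
  next
    assume uv: "u \<notin> VP" "v \<notin> VP"
    let ?D = "a u \<bullet> rot90 (a v)"
    have D: "?D \<noteq> 0" using form uv by (auto simp: edge_form_def)
    have au: "d \<bullet> a u = 0" and av: "d \<bullet> a v = 0" and r: "r = 0" using H V uv by auto
    \<comment> \<open>Cramer's rule for the two equations on \<open>d\<close>; \<open>?D\<close> is
      their determinant up to sign.\<close>
    have "?D * d $ 1 = a u $ 2 * (d \<bullet> a v) - a v $ 2 * (d \<bullet> a u)"
      "?D * d $ 2 = a v $ 1 * (d \<bullet> a u) - a u $ 1 * (d \<bullet> a v)"
      by (simp_all add: inner_real2 algebra_simps)
    then have "d = 0" using D unfolding au av by (simp add: eq_real2_iff)
    then show ?thesis using r by simp
  qed
  then show ?thesis by (simp add: t zero_prod_def)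
qed

lemma dim_flexes_ge_3:
  assumes "\<And>e. e \<in> E \<Longrightarrow> e \<subseteq> V \<and> card e = 2"
    and "e \<in> E" "edge_functional VP p a e w \<noteq> 0"
  shows "3 \<le> dim (flexes VP V E p a)"
proof -
  have "dim (UNIV :: ((real^2) \<times> real) set) \<le> dim (flexes VP V E p a)"
  proof (rule dim_le_dim_linear_inj[OF linear_rigid_velocity])
    show "range (rigid_velocity VP V p a) \<subseteq> flexes VP V E p a"
      using rigid_velocity_in_flexes[OF assms(1)] by blast
    show "t = 0" if "rigid_velocity VP V p a t = 0" for t
      using rigid_velocity_eq_0_imp[OF _ _ assms(3) that] assms(1,2) by blast
  qed simp
  then show ?thesis by simp
qed

text \<open>A functional sees only the velocities at the ends of its edge, so the dual vectors may
  be truncated to \<open>V\<close> and remain dual.\<close>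

lemma dim_flexes_independent:
  fixes E :: "'v::finite set set"
  assumes "\<And>e. e \<in> E \<Longrightarrow> e \<subseteq> V \<and> card e = 2"
    and "\<And>e. e \<in> E \<Longrightarrow> \<exists>m. edge_functional VP p a e m \<noteq> 0 \<and>
      (\<forall>e'\<in>E - {e}. edge_functional VP p a e' m = 0)"
  shows "2 * card V = dim (flexes VP V E p a) + card E"
  unfolding flexes_def dim_supported_on[symmetric]
proof (rule dim_eq_dim_common_kernel[OF subspace_supported_on _ linear_edge_functional])
  fix e assume e: "e \<in> E"
  then obtain m where m: "edge_functional VP p a e m \<noteq> 0"
    "\<forall>e'\<in>E - {e}. edge_functional VP p a e' m = 0" using assms(2) by blast
  define m' where "m' = (\<chi> v. if v \<in> V then m $ v else 0)"
  have "edge_functional VP p a e' m' = edge_functional VP p a e' m" if "e' \<in> E" for e'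
    using assms(1)[OF that] by (intro edge_functional_cong) (auto simp: m'_def)
  moreover have "m' \<in> supported_on V" by (simp add: m'_def supported_on_def)
  ultimately show "\<exists>m\<in>supported_on V. edge_functional VP p a e m \<noteq> 0 \<and>
      (\<forall>e'\<in>E - {e}. edge_functional VP p a e' m = 0)"
    using m e by (intro bexI[of _ m']) auto
qed simp

text \<open>Deleting \<open>e\<close> enlarges the space of motions, and a motion gained in this way
  violates the equation of \<open>e\<close> only.\<close>

lemma isostatic_dual_flex:
  fixes E :: "'v::finite set set"
  assumes G: "point_line_graph VP VH E" and unit: "\<And>j. j \<in> VH \<Longrightarrow> norm (fst (L j)) = 1"
    and iso: "isostatic VP VH E p L" and e: "e \<in> E"
  obtains m where "m \<in> supported_on (VP \<union> VH)" "edge_functional VP p (\<lambda>j. fst (L j)) e m \<noteq> 0"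
    "\<And>e'. e' \<in> E - {e} \<Longrightarrow> edge_functional VP p (\<lambda>j. fst (L j)) e' m = 0"
proof -
  let ?a = "\<lambda>j. fst (L j)" and ?V = "VP \<union> VH"
  have G': "point_line_graph VP VH (E - {e})" using G by (auto simp: point_line_graph_def)
  have "dim (flexes VP ?V E p ?a) = 3" "dim (flexes VP ?V (E - {e}) p ?a) \<noteq> 3"
    using iso e dim_infinitesimal_motions[OF G unit] dim_infinitesimal_motions[OF G' unit]
    by (auto simp: isostatic_def infinitesimally_rigid_def)
  then have "flexes VP ?V (E - {e}) p ?a \<noteq> flexes VP ?V E p ?a" by auto
  then show thesis using that by (auto simp: flexes_def)
qed

text \<open>The symmetric velocities have dimension at most \<open>card (VP \<union> VH)\<close>.
  One equation per edge orbit is independent on them, and the rotation about the origin survives, so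
  the number of orbits plus 1 is at most the number of vertices. Doubling gives the claim, since a
  fixed edge is an orbit of its own.\<close>

lemma card_fixed_edges_le:
  fixes E :: "'v::finite set set" and g :: "'v \<Rightarrow> 'v"
  assumes disj: "VP \<inter> VH = {}" and E: "\<And>e. e \<in> E \<Longrightarrow> e \<subseteq> VP \<union> VH \<and> card e = 2"
    and gg: "\<And>v. g (g v) = v" and gP: "\<And>v. v \<in> VP \<Longrightarrow> g v \<in> VP \<and> g v \<noteq> v"
    and gH: "\<And>v. v \<in> VH \<Longrightarrow> g v = v" and gE: "\<And>e. e \<in> E \<Longrightarrow> g ` e \<in> E"
    and pg: "\<And>v. v \<in> VP \<Longrightarrow> p (g v) = - p v"
    and dual: "\<And>e. e \<in> E \<Longrightarrow> \<exists>m\<in>supported_on (VP \<union> VH). edge_functional VP p a e m \<noteq> 0 \<and>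
      (\<forall>e'\<in>E - {e}. edge_functional VP p a e' m = 0)"
    and ne: "E \<noteq> {}"
  shows "card E + card {e \<in> E. g ` e = e} + 2 \<le> 2 * card (VP \<union> VH)"
proof -
  let ?V = "VP \<union> VH" and ?f = "edge_functional VP p a"
  \<comment> \<open>The half-turn acting on encoded velocities. It preserves the angular velocity of
    a line; when the normal is kept, the offset of the image line has the opposite sign, and so has
    its velocity.\<close>
  define \<Gamma> :: "(real^2)^'v \<Rightarrow> (real^2)^'v" where
    "\<Gamma> w = (\<chi> v. if v \<in> VP then - (w $ g v) else vector [w $ v $ 1, - (w $ v $ 2)])" for w
  have gnP: "g v \<notin> VP" if "v \<notin> VP" for v using gP[of "g v"] that by (auto simp: gg)
  have lin\<Gamma>: "linear \<Gamma>" by (rule linearI) (auto simp: \<Gamma>_def eq_real2_iff vec_eq_iff[where 'b = 'v])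
  have \<Gamma>\<Gamma>: "\<Gamma> (\<Gamma> w) = w" for w
    using gP by (auto simp: \<Gamma>_def eq_real2_iff vec_eq_iff[where 'b = 'v] gg)
  have \<Gamma>supp: "\<Gamma> w \<in> supported_on ?V" if "w \<in> supported_on ?V" for w
    using that by (auto simp: supported_on_def \<Gamma>_def eq_real2_iff)
  \<comment> \<open>The sign \<open>s\<close> is -1 exactly for point-line edges. Such an edge is
    never fixed, because \<open>g\<close> fixes its line and moves its point.\<close>
  have form: "\<exists>s::real. (s = 1 \<or> g ` e \<noteq> e) \<and> (\<forall>w. ?f e (\<Gamma> w) = s * ?f (g ` e) w)" if e: "e \<in> E" for e
  proof -
    obtain u v where uv: "e = {u, v}" using E[OF e] by (meson card_2_iff)
    have V: "u \<in> ?V" "v \<in> ?V" using E[OF e] uv by auto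
    have ge: "g ` e = {g u, g v}" using uv by simp
    show ?thesis
    proof (cases "u \<in> VP \<longleftrightarrow> v \<in> VP")
      case True
      have "edge_form VP p a u v (\<Gamma> w) = edge_form VP p a (g u) (g v) w" for w
        using True V gP gH gnP by (auto simp: edge_form_def \<Gamma>_def pg inner_real2 algebra_simps)
      then show ?thesis
        unfolding ge by (intro exI[of _ 1]) (simp add: uv edge_functional_pair)
    next
      case False
      have "edge_form VP p a u v (\<Gamma> w) = - edge_form VP p a (g u) (g v) w" for w
        using False V gP gH gnP by (auto simp: edge_form_def \<Gamma>_def pg inner_real2 algebra_simps)
      moreover have "{g u, g v} \<noteq> {u, v}"
        using False V gP gH gnP by (auto simp: doubleton_eq_iff)
      ultimately show ?thesis
        unfolding ge by (intro exI[of _ "- 1"]) (simp add: uv edge_functional_pair)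
    qed
  qed
  have ggE: "g ` g ` e = e" for e by (simp add: image_image gg)
  obtain R where R: "R \<subseteq> E" "(`) g ` R \<inter> R = {}"
    "card E = card {e \<in> E. g ` e = e} + 2 * card R"
  proof (rule involution_representatives[of E "(`) g"])
    show "g ` e \<in> E" "g ` g ` e = e" if "e \<in> E" for e using gE[OF that] ggE by auto
  qed
  have Rg: "g ` e \<noteq> e" if "e \<in> R" for e using R(2) that by auto
  \<comment> \<open>\<open>F\<close> contains one edge of each orbit.\<close>
  define F where "F = {e \<in> E. g ` e = e} \<union> R"
  have FE: "F \<subseteq> E" using R(1) by (auto simp: F_def)
  have orbit: "g ` e' \<noteq> e" if "e \<in> F" "e' \<in> F" "e' \<noteq> e" for e e'
  proof
    assume eq: "g ` e' = e"
    then have eq': "g ` e = e'" using ggE by blast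
    have "e' \<in> R" using that eq by (auto simp: F_def)
    then have "e \<in> (`) g ` R" using eq by blast
    moreover have "e \<in> R" using that eq' by (auto simp: F_def)
    ultimately show False using R(2) by blast
  qed
  have cardF: "card F = card {e \<in> E. g ` e = e} + card R"
    unfolding F_def using Rg by (intro card_Un_disjoint) auto
  define Z where "Z = {w \<in> supported_on ?V. \<Gamma> w = w}"
  have subZ: "subspace Z"
    unfolding Z_def using subspace_supported_on[of ?V] lin\<Gamma>
    by (auto simp: subspace_def linear_0 linear_add linear_cmul)
  have "dim Z = dim {w \<in> Z. \<forall>e\<in>F. ?f e w = 0} + card F"
  proof (rule dim_eq_dim_common_kernel[OF subZ _ linear_edge_functional])
    fix e assume e: "e \<in> F"
    obtain m where m: "m \<in> supported_on ?V" "?f e m \<noteq> 0" "\<forall>e'\<in>E - {e}. ?f e' m = 0"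
      using dual[OF subsetD[OF FE e]] by auto
    \<comment> \<open>The symmetrised dual vector is nonzero on the orbit of \<open>e\<close> only.
      On a fixed edge the two summands have equal values because \<open>s = 1\<close>, so they do
      not cancel.\<close>
    have "m + \<Gamma> m \<in> supported_on ?V"
      using m(1) \<Gamma>supp[OF m(1)] by (rule subspace_add[OF subspace_supported_on])
    moreover have "\<Gamma> (m + \<Gamma> m) = m + \<Gamma> m"
      unfolding linear_add[OF lin\<Gamma>] \<Gamma>\<Gamma> by (rule add.commute)
    ultimately have Z: "m + \<Gamma> m \<in> Z" by (simp add: Z_def)
    have add: "?f e' (m + \<Gamma> m) = ?f e' m + ?f e' (\<Gamma> m)" for e'
      by (rule linear_add[OF linear_edge_functional])
    have "?f e' (m + \<Gamma> m) = 0" if "e' \<in> F - {e}" for e'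
    proof -
      have e': "e' \<in> F" "e' \<noteq> e" "e' \<in> E" using that FE by auto
      obtain s where "?f e' (\<Gamma> m) = s * ?f (g ` e') m" using form[OF e'(3)] by blast
      moreover have "?f (g ` e') m = 0" using m(3) orbit[OF e e'(1,2)] gE[OF e'(3)] by blast
      ultimately show ?thesis using m(3) e' by (simp add: add)
    qed
    moreover have "?f e (m + \<Gamma> m) \<noteq> 0"
    proof -
      have eE: "e \<in> E" using e FE by blast
      obtain s where s: "s = 1 \<or> g ` e \<noteq> e" "?f e (\<Gamma> m) = s * ?f (g ` e) m" using form[OF eE] by blast
      show ?thesis
      proof (cases "g ` e = e")
        case True
        then show ?thesis using s m(2) by (simp add: add)
      next
        case False
        then have "?f (g ` e) m = 0" using m(3) gE[OF eE] by blast
        then show ?thesis using s m(2) by (simp add: add)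
      qed
    qed
    ultimately show "\<exists>m\<in>Z. ?f e m \<noteq> 0 \<and> (\<forall>e'\<in>F - {e}. ?f e' m = 0)" using Z by blast
  qed simp
  moreover have "1 \<le> dim {w \<in> Z. \<forall>e\<in>F. ?f e w = 0}"
  proof -
    \<comment> \<open>The rotation about the origin is a motion that commutes with the
      half-turn.\<close>
    define w where "w = rigid_velocity VP ?V p a (0, 1)"
    obtain e where e: "e \<in> E" using ne by blast
    then obtain m where "?f e m \<noteq> 0" using dual by blast
    then have "w \<noteq> 0"
      using rigid_velocity_eq_0_imp[of e ?V VP p a m "(0, 1)"] E[OF e] by (auto simp: w_def zero_prod_def)
    have "w \<in> flexes VP ?V E p a" unfolding w_def using E by (rule rigid_velocity_in_flexes)
    moreover have "\<Gamma> w = w"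
      using gP gH disj
      by (auto simp: \<Gamma>_def w_def rigid_velocity_def eq_real2_iff vec_eq_iff[where 'b = 'v] pg)
    ultimately have "w \<in> {w \<in> Z. \<forall>e\<in>F. ?f e w = 0}" using FE by (auto simp: Z_def flexes_def)
    then have "dim {w} \<le> dim {w \<in> Z. \<forall>e\<in>F. ?f e w = 0}" by (intro dim_subset) simp
    moreover have "dim {w} = 1" using \<open>w \<noteq> 0\<close> by (simp add: dim_insert)
    ultimately show ?thesis by simp
  qed
  moreover have "dim Z \<le> card ?V"
  proof -
    obtain h :: "'v \<Rightarrow> nat" where h: "inj h"
      using finite_imp_inj_to_nat_seg[of "UNIV :: 'v set"] by auto
    \<comment> \<open>One real coordinate per vertex determines a symmetric velocity: the two
      components at a point orbit are distributed over its two vertices, and for a line only the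
      angular velocity can be nonzero.\<close>
    define \<zeta> :: "(real^2)^'v \<Rightarrow> real^'v" where
      "\<zeta> w = (\<chi> v. if v \<in> VP \<and> h (g v) < h v then w $ v $ 2 else w $ v $ 1)" for w
    have "dim Z \<le> dim {z :: real^'v. \<forall>v. v \<notin> ?V \<longrightarrow> z $ v = 0}"
    proof (rule dim_le_dim_linear_inj[where f = \<zeta>, OF _ subZ])
      show "linear \<zeta>" by (rule linearI) (auto simp: \<zeta>_def vec_eq_iff)
      show "\<zeta> ` Z \<subseteq> {z. \<forall>v. v \<notin> ?V \<longrightarrow> z $ v = 0}"
        by (auto simp: \<zeta>_def Z_def supported_on_def)
      fix w assume w: "w \<in> Z" "\<zeta> w = 0"
      have \<zeta>0: "(if v \<in> VP \<and> h (g v) < h v then w $ v $ 2 else w $ v $ 1) = 0" for v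
        using arg_cong[OF w(2), of "\<lambda>z. z $ v"] by (simp add: \<zeta>_def)
      have \<Gamma>w: "\<Gamma> w $ v = w $ v" for v using w(1) by (simp add: Z_def)
      have "w $ v = 0" for v
      proof -
        consider "v \<in> VP" | "v \<in> VH" | "v \<notin> ?V" by blast
        then show ?thesis
        proof cases
          case 1
          have "h (g v) \<noteq> h v" using gP[OF 1] injD[OF h] by blast
          moreover have "- w $ g v = w $ v" using \<Gamma>w[of v] 1 by (simp add: \<Gamma>_def)
          then have "w $ g v = - w $ v" by (metis minus_minus)
          ultimately show ?thesis
            using \<zeta>0[of v] \<zeta>0[of "g v"] 1 gP[OF 1] by (auto simp: gg eq_real2_iff split: if_splits)
        next
          case 2
          then have "v \<notin> VP" using disj by auto
          then show ?thesis using \<zeta>0[of v] \<Gamma>w[of v] by (auto simp: \<Gamma>_def eq_real2_iff)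
        next
          case 3
          then show ?thesis using w(1) by (simp add: Z_def supported_on_def)
        qed
      qed
      then show "w = 0" by (simp add: vec_eq_iff)
    qed
    also have "dim {z :: real^'v. \<forall>v. v \<notin> ?V \<longrightarrow> z $ v = 0} = card ?V"
      using dim_substandard_cart[of ?V, where 'a = real] by (simp add: dim_vec_eq)
    finally show ?thesis .
  qed
  ultimately show ?thesis using cardF R(3) by linarith
qed

section \<open>Half-turn symmetric realisations\<close>

text \<open>With \<open>z0\<close> the point of the line nearest to the origin, subtracting a
  suitable multiple of \<open>x - z0\<close> from any \<open>y\<close> lands on the line. This
  writes \<open>y\<close> as an affine combination of \<open>x\<close> and two points of the
  line.\<close>

lemma affine_hull_line_and_point:
  assumes "norm a = 1" "line_of (a, r) \<subseteq> S" "x \<in> S" "a \<bullet> x + r \<noteq> 0"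
  shows "affine hull S = UNIV"
proof -
  have "y \<in> affine hull S" for y
  proof -
    define t where "t = (a \<bullet> y + r) / (a \<bullet> x + r)"
    define z0 where "z0 = - r *\<^sub>R a"
    define z1 where "z1 = y - t *\<^sub>R (x - z0)"
    have aa: "a \<bullet> a = 1" using assms(1) by (simp add: norm_eq_1)
    have "z0 \<in> line_of (a, r)" by (simp add: line_of_def z0_def aa)
    moreover have "z1 \<in> line_of (a, r)"
      using assms(4) by (simp add: line_of_def z1_def z0_def t_def inner_diff_right inner_add_right aa)
    ultimately have "z0 \<in> affine hull S" "z1 \<in> affine hull S" "x \<in> affine hull S"
      using assms(2,3) hull_subset[of S affine] by blast+
    then have "t *\<^sub>R x + 1 *\<^sub>R z1 + (- t) *\<^sub>R z0 \<in> affine hull S"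
      by (intro mem_affine_3) auto
    then show ?thesis by (simp add: z1_def algebra_simps)
  qed
  then show ?thesis by blast
qed

text \<open>
  A projective map sends the reflection axis to infinity: vertices on the axis become lines, whose
  normal is given by the position on the axis, and the reflection becomes the half-turn.
\<close>

lemma half_turn_symmetric_rigid_realisation:
  fixes E :: "'v::finite set set" and g :: "'v \<Rightarrow> 'v"
  assumes disj: "VP \<inter> VH = {}" and E: "\<And>e. e \<in> E \<Longrightarrow> e \<subseteq> VP \<union> VH \<and> card e = 2"
    and gg: "\<And>v. g (g v) = v" and gP: "\<And>v. v \<in> VP \<Longrightarrow> g v \<in> VP \<and> g v \<noteq> v"
    and gH: "\<And>v. v \<in> VH \<Longrightarrow> g v = v" and gE: "\<And>e. e \<in> E \<Longrightarrow> g ` e \<in> E"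
    and cardE: "card E + 3 = 2 * card (VP \<union> VH)"
    and sparse: "\<And>C F. C \<subseteq> VP \<union> VH \<Longrightarrow> F \<subseteq> E \<Longrightarrow> F \<noteq> {} \<Longrightarrow> (\<And>e. e \<in> F \<Longrightarrow> e \<subseteq> C) \<Longrightarrow>
      card F + 3 \<le> 2 * card C"
    and fixed: "card {e \<in> E. g ` e = e} = 1"
    and big: "VH = {} \<Longrightarrow> 3 \<le> card VP"
  obtains p L where "point_line_framework VP VH E p L" "\<forall>v. p (g v) = - p v"
    "dim (flexes VP (VP \<union> VH) E p (\<lambda>j. fst (L j))) \<le> 3"
proof -
  let ?V = "VP \<union> VH"
  obtain f where f: "{e \<in> E. g ` e = e} = {f}" using fixed by (meson card_1_singletonE)
  have gV: "g v \<in> ?V" if "v \<in> ?V" for v using that gP gH by auto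
  obtain X Y :: "'v \<Rightarrow> real" where XYg: "\<forall>v. X (g v) = - X v" "\<forall>v. Y (g v) = Y v"
    and X0: "\<forall>v\<in>?V. g v \<noteq> v \<longrightarrow> X v \<noteq> 0"
    and Yne: "\<forall>u v. {u, v} \<in> E \<longrightarrow> g ` {u, v} \<noteq> {u, v} \<longrightarrow> Y u \<noteq> Y v"
    and dimK: "dim {w :: (real^2)^'v. (\<forall>v. v \<notin> ?V \<longrightarrow> w $ v = 0) \<and>
      (\<forall>u v. {u, v} \<in> E \<longrightarrow>
        (X u - X v) * (w $ u $ 1 - w $ v $ 1) + (Y u - Y v) * (w $ u $ 2 - w $ v $ 2) = 0)} \<le> 3"
    by (rule reflection_symmetric_realisation[OF gg gV E gE cardE sparse f])
  have Xg: "X (g v) = - X v" and Yg: "Y (g v) = Y v" for v using XYg by simp_all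
  have XP: "X v \<noteq> 0" if "v \<in> VP" for v using X0 gP that by blast
  have XH: "X v = 0" if "v \<in> VH" for v using Xg[of v] gH[OF that] by simp
  obtain h :: "'v \<Rightarrow> nat" where h: "inj h"
    using finite_imp_inj_to_nat_seg[of "UNIV :: 'v set"] by auto
  define N where "N v = sqrt (1 + Y v * Y v)" for v
  have Npos: "N v > 0" and NN: "N v * N v = 1 + Y v * Y v" for v
    by (auto simp: N_def add_pos_nonneg)
  \<comment> \<open>Offsets do not enter the edge equations and can be chosen freely. Positive
    values keep the lines away from the origin, and distinct values keep distinct vertices from
    giving the same line.\<close>
  define \<rho> where "\<rho> v = real (h v) + 1" for v
  \<comment> \<open>In homogeneous coordinates the map is \<open>(X, Y, 1)\<close> to
    \<open>(1, - Y, X)\<close>. A vertex with \<open>X = 0\<close> goes to the point at infinity in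
    direction \<open>(1, - Y)\<close>, which is normalised by \<open>N\<close> to the unit normal
    \<open>a\<close>.\<close>
  define p :: "'v \<Rightarrow> real^2" where "p v = vector [1 / X v, - Y v / X v]" for v
  define a :: "'v \<Rightarrow> real^2" where "a v = vector [1 / N v, - Y v / N v]" for v
  define L where "L v = (a v, \<rho> v / N v)" for v
  have pv: "p v $ 1 = 1 / X v" "p v $ 2 = - Y v / X v" for v by (simp_all add: p_def)
  have av: "a v $ 1 = 1 / N v" "a v $ 2 = - Y v / N v" for v by (simp_all add: a_def)
  have pg: "p (g v) = - p v" for v by (simp add: eq_real2_iff pv Xg Yg)
  have unit: "norm (a v) = 1" for v
  proof -
    have "(1 + Y v * Y v) / (N v * N v) = 1" using Npos[of v] by (simp add: NN[symmetric])
    then show ?thesis by (simp add: norm_eq_1_real2 av add_divide_distrib)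
  qed
  have on_line: "a j \<bullet> x + \<rho> j / N j = (x $ 1 - Y j * x $ 2 + \<rho> j) / N j" for j x
    by (simp add: inner_real2 av add_divide_distrib diff_divide_distrib)
  have "affine hull (p ` VP \<union> (\<Union>j\<in>VH. line_of (L j))) = UNIV" (is "affine hull ?S = UNIV")
  proof (cases "VH = {}")
    case False
    then obtain j where j: "j \<in> VH" by blast
    have "\<exists>x\<in>?S. x $ 1 - Y j * x $ 2 + \<rho> j \<noteq> 0"
    proof (cases "VP = {}")
      case False
      then obtain i where i: "i \<in> VP" by blast
      \<comment> \<open>If both \<open>p i\<close> and \<open>- p i\<close> lay on the line, adding
        their equations would give \<open>\<rho> j = 0\<close>.\<close>
      have \<rho>0: "\<rho> j \<noteq> 0" by (simp add: \<rho>_def add_nonneg_eq_0_iff)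
      show ?thesis
      proof (cases "p i $ 1 - Y j * p i $ 2 + \<rho> j = 0")
        case True
        then have "p (g i) $ 1 - Y j * p (g i) $ 2 + \<rho> j \<noteq> 0"
          unfolding pg using \<rho>0 by (simp add: algebra_simps)
        then show ?thesis using gP[OF i] by blast
      qed (use i in blast)
    next
      case True
      \<comment> \<open>The edge count excludes a single line, and a second line contains a point
        off the first because the offsets differ.\<close>
      have "VH \<noteq> {j}" using cardE True by auto
      then obtain k where k: "k \<in> VH" "k \<noteq> j" using j by blast
      define x :: "real^2" where "x = vector [- \<rho> k, 0]"
      have "x \<in> line_of (L k)" by (simp add: line_of_def L_def on_line x_def)
      moreover have "\<rho> k \<noteq> \<rho> j" using k(2) injD[OF h] by (auto simp: \<rho>_def)
      ultimately show ?thesis using k(1) by (intro bexI[of _ x]) (auto simp: x_def)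
    qed
    then obtain x where "x \<in> ?S" "x $ 1 - Y j * x $ 2 + \<rho> j \<noteq> 0" by blast
    moreover have "line_of (a j, \<rho> j / N j) \<subseteq> ?S" using j by (force simp: L_def)
    ultimately show ?thesis
      using Npos[of j] unit[of j] by (intro affine_hull_line_and_point[of "a j" "\<rho> j / N j" _ x]) (auto simp: on_line)
  next
    case True
    \<comment> \<open>An edge other than \<open>f\<close> has ends with different \<open>Y\<close>,
      so \<open>p u\<close> and \<open>p v\<close> are linearly independent; the midpoint of
      \<open>p u\<close> and \<open>p (g u)\<close> is the origin.\<close>
    have "card E \<noteq> 1" using cardE big[OF True] True by simp
    then have "E \<noteq> {f}" by auto
    moreover have "f \<in> E" using f by auto
    ultimately obtain e where e: "e \<in> E" "e \<noteq> f" by blast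
    then have ge: "g ` e \<noteq> e" using f by auto
    obtain u v where uv: "e = {u, v}" using E[OF e(1)] by (meson card_2_iff)
    have VP: "u \<in> VP" "v \<in> VP" using E[OF e(1)] uv True by auto
    have "Y u \<noteq> Y v" using Yne[rule_format, of u v] e(1) ge unfolding uv by blast
    then have Y: "Y v - Y u \<noteq> 0" by simp
    have S: "p u \<in> affine hull ?S" "p (g u) \<in> affine hull ?S" "p v \<in> affine hull ?S"
      using VP gP hull_subset[of ?S affine] by blast+
    have "y \<in> affine hull ?S" for y
    proof -
      \<comment> \<open>\<open>m\<close> and \<open>k\<close> are the coordinates of
        \<open>y\<close> with respect to \<open>(1, - Y u)\<close> and \<open>(1, - Y v)\<close>;
        \<open>\<mu>\<close> and \<open>\<kappa>\<close> rescale them to \<open>p u\<close> and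
        \<open>p v\<close>. The weights of \<open>p u\<close> and \<open>p (g u)\<close> differ by
        \<open>\<mu>\<close> and bring the total to 1.\<close>
      define k where "k = (- y $ 2 - Y u * y $ 1) / (Y v - Y u)"
      define m where "m = y $ 1 - k"
      have kY: "k * (Y v - Y u) = - y $ 2 - Y u * y $ 1" using Y by (simp add: k_def)
      define \<kappa> \<mu> where "\<kappa> = k * X v" and "\<mu> = m * X u"
      have "((1 - \<kappa> + \<mu>) / 2) *\<^sub>R p u + ((1 - \<kappa> - \<mu>) / 2) *\<^sub>R p (g u) + \<kappa> *\<^sub>R p v \<in> affine hull ?S"
        by (intro mem_affine_3 S) (auto simp: field_simps)
      moreover have "((1 - \<kappa> + \<mu>) / 2) *\<^sub>R p u + ((1 - \<kappa> - \<mu>) / 2) *\<^sub>R p (g u) + \<kappa> *\<^sub>R p v =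
          \<mu> *\<^sub>R p u + \<kappa> *\<^sub>R p v"
        unfolding pg by (simp add: eq_real2_iff field_simps)
      moreover have "\<mu> *\<^sub>R p u + \<kappa> *\<^sub>R p v = y"
      proof -
        have "m * Y u + k * Y v = - y $ 2" using kY by (simp add: m_def algebra_simps)
        then show ?thesis
          using XP[OF VP(1)] XP[OF VP(2)] by (simp add: eq_real2_iff pv \<kappa>_def \<mu>_def m_def algebra_simps)
      qed
      ultimately show ?thesis by simp
    qed
    then show ?thesis by blast
  qed
  then have fw: "point_line_framework VP VH E p L"
    using disj E unit by (auto simp: point_line_framework_def point_line_graph_def L_def)
  \<comment> \<open>This is how the projective map acts on velocities. It is injective and turns
    each bar equation into a nonzero multiple of the corresponding point-line equation, with the
    factors found in \<open>qPP\<close>, \<open>qPH\<close> and \<open>qHH\<close>.\<close>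
  define \<Psi> :: "(real^2)^'v \<Rightarrow> (real^2)^'v" where
    "\<Psi> w = (\<chi> v. if v \<in> VP then vector [w $ v $ 1 - Y v * w $ v $ 2, X v * w $ v $ 2]
      else vector [- N v * w $ v $ 2, w $ v $ 1])" for w
  have \<Psi>P: "\<Psi> w $ v $ 1 = w $ v $ 1 - Y v * w $ v $ 2" "\<Psi> w $ v $ 2 = X v * w $ v $ 2" if "v \<in> VP" for w v
    using that by (simp_all add: \<Psi>_def)
  have \<Psi>H: "\<Psi> w $ v $ 1 = - N v * w $ v $ 2" "\<Psi> w $ v $ 2 = w $ v $ 1" if "v \<notin> VP" for w v
    using that by (simp_all add: \<Psi>_def)
  define q where "q w u v = (X u - X v) * (\<Psi> w $ u $ 1 - \<Psi> w $ v $ 1) +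
    (Y u - Y v) * (\<Psi> w $ u $ 2 - \<Psi> w $ v $ 2)" for w u v
  have qsym: "q w u v = q w v u" for w u v by (simp add: q_def algebra_simps)
  have qPP: "q w u v = - (X u * X v) * edge_form VP p a u v w" if "u \<in> VP" "v \<in> VP" for u v w
    using that XP[OF that(1)] XP[OF that(2)]
    by (simp add: q_def \<Psi>P edge_form_def inner_real2 pv field_simps)
  have qPH: "q w u v = X u * N v * edge_form VP p a u v w" if "u \<in> VP" "v \<notin> VP" "X v = 0" for u v w
    using that XP[OF that(1)] Npos[of v]
    by (simp add: q_def \<Psi>P \<Psi>H edge_form_def inner_real2 pv av field_simps)
  have qHH: "q w u v = N u * N v * edge_form VP p a u v w"
    if "u \<notin> VP" "v \<notin> VP" "X u = 0" "X v = 0" for u v w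
    using that Npos[of u] Npos[of v]
    by (simp add: q_def \<Psi>H edge_form_def inner_real2 av field_simps)
  have "dim (flexes VP ?V E p a) \<le> dim {w :: (real^2)^'v. (\<forall>v. v \<notin> ?V \<longrightarrow> w $ v = 0) \<and>
      (\<forall>u v. {u, v} \<in> E \<longrightarrow>
        (X u - X v) * (w $ u $ 1 - w $ v $ 1) + (Y u - Y v) * (w $ u $ 2 - w $ v $ 2) = 0)}"
    (is "_ \<le> dim ?K")
  proof (rule dim_le_dim_linear_inj[where f = \<Psi>, OF _ subspace_flexes])
    show "linear \<Psi>"
      by (rule linearI) (auto simp: \<Psi>_def vec_eq_iff[where 'b = 'v] eq_real2_iff algebra_simps)
    show "w = 0" if "\<Psi> w = 0" for w
    proof -
      have "w $ v = 0" for v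
      proof (cases "v \<in> VP")
        case True
        then show ?thesis using \<Psi>P[OF True, of w] XP[OF True] that by (auto simp: eq_real2_iff)
      next
        case False
        then show ?thesis using \<Psi>H[OF False, of w] Npos[of v] that by (auto simp: eq_real2_iff)
      qed
      then show ?thesis by (simp add: vec_eq_iff)
    qed
    show "\<Psi> ` flexes VP ?V E p a \<subseteq> ?K"
    proof
      fix y assume "y \<in> \<Psi> ` flexes VP ?V E p a"
      then obtain w where y: "y = \<Psi> w" and w: "w \<in> flexes VP ?V E p a" by blast
      have "\<Psi> w $ v = 0" if "v \<notin> ?V" for v
        using that w by (auto simp: \<Psi>_def flexes_def supported_on_def eq_real2_iff)
      moreover have "q w u v = 0" if uvE: "{u, v} \<in> E" for u v
      proof -
        have form: "edge_form VP p a u v w = 0" "edge_form VP p a v u w = 0"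
          using w uvE by (auto simp: flexes_def edge_functional_pair[symmetric] insert_commute)
        have "u \<in> ?V" "v \<in> ?V" using E[OF uvE] by auto
        then consider "u \<in> VP" "v \<in> VP" | "u \<in> VP" "v \<in> VH" | "u \<in> VH" "v \<in> VP" | "u \<in> VH" "v \<in> VH"
          by blast
        then show ?thesis
        proof cases
          case 1
          then show ?thesis by (simp add: qPP form)
        next
          case 2
          then have "v \<notin> VP" using disj by blast
          then show ?thesis using qPH[OF 2(1) _ XH[OF 2(2)]] form by simp
        next
          case 3
          then have "u \<notin> VP" using disj by blast
          then show ?thesis using qPH[OF 3(2) _ XH[OF 3(1)]] form by (simp add: qsym[of w u v])
        next
          case 4
          then have "u \<notin> VP" "v \<notin> VP" using disj by blast+
          then show ?thesis using qHH[OF _ _ XH[OF 4(1)] XH[OF 4(2)]] form by simp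
        qed
      qed
      ultimately show "y \<in> ?K" by (simp add: y q_def)
    qed
  qed
  with dimK have "dim (flexes VP ?V E p (\<lambda>j. fst (L j))) \<le> 3" by (simp add: L_def)
  moreover have "\<forall>v. p (g v) = - p v" by (simp add: pg)
  ultimately show ?thesis using fw that by blast
qed

section \<open>The group of order two and its actions\<close>

lemma carrier_half_turn_group_subset: "carrier half_turn_group \<subseteq> {id, uminus}"
proof
  fix f assume "f \<in> carrier half_turn_group"
  then have "f \<in> generate orthogonal_group (carrier orthogonal_group \<inter> {\<lambda>x. - x})"
    by (simp only: half_turn_group_def carrier_subgroup_generated)
  then show "f \<in> {id, uminus}"
  proof induction
    case one
    then show ?case by (simp add: orthogonal_group_def)
  next
    case (incl h)
    then show ?case by simp
  next
    case (inv h)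
    have "inv\<^bsub>orthogonal_group\<^esub> (uminus :: real^2 \<Rightarrow> real^2) = uminus"
      unfolding m_inv_def
    proof (rule the_equality)
      show "(uminus :: real^2 \<Rightarrow> real^2) \<in> carrier orthogonal_group \<and>
          uminus \<otimes>\<^bsub>orthogonal_group\<^esub> uminus = \<one>\<^bsub>orthogonal_group\<^esub> \<and>
          uminus \<otimes>\<^bsub>orthogonal_group\<^esub> uminus = \<one>\<^bsub>orthogonal_group\<^esub>"
        by (auto simp: orthogonal_group_def orthogonal_transformation_def linear_uminus fun_eq_iff)
      fix y :: "real^2 \<Rightarrow> real^2"
      assume "y \<in> carrier orthogonal_group \<and> uminus \<otimes>\<^bsub>orthogonal_group\<^esub> y = \<one>\<^bsub>orthogonal_group\<^esub> \<and>
          y \<otimes>\<^bsub>orthogonal_group\<^esub> uminus = \<one>\<^bsub>orthogonal_group\<^esub>"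
      then have "- y x = x" for x by (auto simp: orthogonal_group_def fun_eq_iff)
      then show "y = uminus" by (metis ext minus_minus)
    qed
    then show ?case using inv by simp
  next
    case (eng h1 h2)
    then show ?case by (auto simp: orthogonal_group_def fun_eq_iff)
  qed
qed

lemma carrier_Z2: "carrier Z2 = {0, 1}"
  by (auto simp: carrier_integer_mod_group)

text \<open>The map \<open>\<tau> 0\<close> is idempotent under composition, which excludes
  \<open>uminus\<close>; injectivity then determines \<open>\<tau> 1\<close>.\<close>

lemma iso_Z2_half_turn_group:
  assumes "\<tau> \<in> iso Z2 half_turn_group"
  shows "\<tau> 0 = id" "\<tau> 1 = uminus"
proof -
  have hom: "\<tau> \<in> hom Z2 half_turn_group" and bij: "bij_betw \<tau> {0, 1} (carrier half_turn_group)"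
    using assms by (auto simp: iso_def carrier_Z2)
  have in2: "\<tau> 0 \<in> {id, uminus}" "\<tau> 1 \<in> {id, uminus}"
    using bij carrier_half_turn_group_subset by (auto simp: bij_betw_def)
  have ne: "\<tau> 0 \<noteq> \<tau> 1" using bij by (auto simp: bij_betw_def inj_on_def)
  have "\<tau> (0 \<otimes>\<^bsub>Z2\<^esub> 0) = \<tau> 0 \<otimes>\<^bsub>half_turn_group\<^esub> \<tau> 0"
    using hom by (intro hom_mult) (auto simp: carrier_Z2)
  then have "\<tau> 0 = \<tau> 0 \<circ> \<tau> 0"
    by (simp add: half_turn_group_def orthogonal_group_def mult_integer_mod_group)
  moreover have "(uminus :: real^2 \<Rightarrow> real^2) \<noteq> uminus \<circ> uminus"
  proof
    assume "(uminus :: real^2 \<Rightarrow> real^2) = uminus \<circ> uminus"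
    then have "- (axis 1 1 :: real^2) = (uminus \<circ> uminus) (axis 1 1)" by (rule fun_cong)
    then show False by (simp add: eq_real2_iff axis_def)
  qed
  ultimately show "\<tau> 0 = id" using in2(1) by auto
  then show "\<tau> 1 = uminus" using ne in2(2) by auto
qed

lemma generate_Z2_imp_eq_1:
  assumes "\<gamma> \<in> carrier Z2" "generate Z2 {\<gamma>} = carrier Z2"
  shows "\<gamma> = 1"
proof (rule ccontr)
  assume "\<gamma> \<noteq> 1"
  then have "\<gamma> = \<one>\<^bsub>Z2\<^esub>" using assms(1) by (auto simp: carrier_Z2)
  then have "generate Z2 {\<gamma>} = {0}" using group.generate_one[OF group_integer_mod_group] by simp
  then show False using assms(2) by (auto simp: carrier_Z2)
qed

text \<open>The map \<open>\<theta> 0\<close> is idempotent and injective on the vertex set, hence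
  the identity there, and \<open>1\<close> is its own inverse in \<open>Z2\<close>. Composition is
  restricted to the vertex set, so these equations are stated only there.\<close>

lemma hom_Z2_Aut_PH:
  assumes "\<theta> \<in> hom Z2 (Aut_PH VP VH E)"
  shows "\<theta> 1 ` VP = VP" "\<theta> 1 ` VH = VH"
    and "\<And>i j. i \<in> VP \<union> VH \<Longrightarrow> j \<in> VP \<union> VH \<Longrightarrow> {\<theta> 1 i, \<theta> 1 j} \<in> E \<longleftrightarrow> {i, j} \<in> E"
    and "\<And>i. i \<in> VP \<union> VH \<Longrightarrow> \<theta> 0 i = i" "\<And>i. i \<in> VP \<union> VH \<Longrightarrow> \<theta> 1 (\<theta> 1 i) = i"
proof -
  let ?V = "VP \<union> VH"
  have carr: "\<theta> 0 \<in> carrier (Aut_PH VP VH E)" "\<theta> 1 \<in> carrier (Aut_PH VP VH E)"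
    using assms by (auto simp: hom_def carrier_Z2)
  then show "\<theta> 1 ` VP = VP" "\<theta> 1 ` VH = VH"
    and "\<And>i j. i \<in> ?V \<Longrightarrow> j \<in> ?V \<Longrightarrow> {\<theta> 1 i, \<theta> 1 j} \<in> E \<longleftrightarrow> {i, j} \<in> E"
    by (auto simp: Aut_PH_def)
  have Bij: "\<theta> 0 \<in> Bij ?V" "\<theta> 1 \<in> Bij ?V" using carr by (auto simp: Aut_PH_def)
  have mult: "x \<otimes>\<^bsub>Aut_PH VP VH E\<^esub> y = compose ?V x y" if "x \<in> Bij ?V" "y \<in> Bij ?V" for x y
    using that by (simp add: Aut_PH_def BijGroup_def)
  have "\<theta> (0 \<otimes>\<^bsub>Z2\<^esub> 0) = \<theta> 0 \<otimes>\<^bsub>Aut_PH VP VH E\<^esub> \<theta> 0"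
    using assms by (intro hom_mult) (auto simp: carrier_Z2)
  then have "\<theta> 0 = compose ?V (\<theta> 0) (\<theta> 0)" by (simp add: mult Bij mult_integer_mod_group)
  then have 00: "\<theta> 0 i = \<theta> 0 (\<theta> 0 i)" if "i \<in> ?V" for i using that by (metis compose_eq)
  have bij: "bij_betw (\<theta> 0) ?V ?V" using Bij(1) by (simp add: Bij_def)
  show 0: "\<theta> 0 i = i" if "i \<in> ?V" for i
  proof -
    have "\<theta> 0 i \<in> ?V" using bij that by (auto dest: bij_betwE)
    then show ?thesis using 00[OF that] bij that by (auto simp: bij_betw_def inj_on_def)
  qed
  have "\<theta> (1 \<otimes>\<^bsub>Z2\<^esub> 1) = \<theta> 1 \<otimes>\<^bsub>Aut_PH VP VH E\<^esub> \<theta> 1"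
    using assms by (intro hom_mult) (auto simp: carrier_Z2)
  then have "\<theta> 0 = compose ?V (\<theta> 1) (\<theta> 1)" by (simp add: mult Bij mult_integer_mod_group)
  then show "\<theta> 1 (\<theta> 1 i) = i" if "i \<in> ?V" for i using that 0[OF that] by (metis compose_eq)
qed

theorem theorem7p4:
  fixes VP VH :: "'v::finite set" and E :: "'v set set"
    and p :: "'v \<Rightarrow> real^2" and L :: "'v \<Rightarrow> (real^2) \<times> real"
    and \<theta> :: "int \<Rightarrow> 'v \<Rightarrow> 'v" and \<tau> :: "int \<Rightarrow> real^2 \<Rightarrow> real^2" and \<gamma> :: int
  assumes "\<gamma> \<in> carrier Z2" and "generate Z2 {\<gamma>} = carrier Z2"
    and "\<theta> \<in> hom Z2 (Aut_PH VP VH E)"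
    and "\<tau> \<in> iso Z2 half_turn_group"
    and "Z2_regular VP VH E \<theta> \<tau> p L"
    and "\<forall>j\<in>VH. \<theta> \<gamma> j = j"
    and "acts_freely_on \<theta> VP"
  shows "isostatic VP VH E p L \<longleftrightarrow>
    tight_2_3 (VP \<union> VH) E \<and> card (fixed_edges E (\<theta> \<gamma>)) = 1"
proof -
  let ?V = "VP \<union> VH" and ?a = "\<lambda>j. fst (L j)"
  have \<gamma>: "\<gamma> = 1" using generate_Z2_imp_eq_1[OF assms(1,2)] .
  note \<tau> = iso_Z2_half_turn_group[OF assms(4)] and \<theta> = hom_Z2_Aut_PH[OF assms(3)]
  have fw: "point_line_framework VP VH E p L" and sym: "Z2_symmetric VP VH \<theta> \<tau> p L"
    and max: "\<And>p' L'. point_line_framework VP VH E p' L' \<Longrightarrow> Z2_symmetric VP VH \<theta> \<tau> p' L' \<Longrightarrow>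
        rank (rigidity_matrix VP VH E p' L') \<le> rank (rigidity_matrix VP VH E p L)"
    using assms(5) by (auto simp: Z2_regular_def)
  have G: "point_line_graph VP VH E" and unit: "\<And>j. j \<in> VH \<Longrightarrow> norm (fst (L j)) = 1"
    and hull: "affine hull (p ` VP \<union> (\<Union>j\<in>VH. line_of (L j))) = UNIV"
    using fw by (auto simp: point_line_framework_def)
  have disj: "VP \<inter> VH = {}" and E: "\<And>e. e \<in> E \<Longrightarrow> e \<subseteq> ?V \<and> card e = 2"
    using G by (auto simp: point_line_graph_def)
  \<comment> \<open>Extension by the identity outside the vertex set, so that \<open>g\<close> is an
    involution of the whole type.\<close>
  define g where "g v = (if v \<in> ?V then \<theta> 1 v else v)" for v
  have g\<theta>: "g v = \<theta> 1 v" if "v \<in> ?V" for v using that by (simp add: g_def)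
  have gH: "g v = v" if "v \<in> VH" for v using that assms(6) by (simp add: g_def \<gamma>)
  have gP: "g v \<in> VP \<and> g v \<noteq> v" if v: "v \<in> VP" for v
  proof
    show "g v \<in> VP" using \<theta>(1) v by (auto simp: g_def)
    show "g v \<noteq> v"
      using assms(7) v unfolding acts_freely_on_def by (auto simp: g_def carrier_Z2)
  qed
  have gV: "g v \<in> ?V" if "v \<in> ?V" for v using that gP gH by auto
  have gg: "g (g v) = v" for v
  proof (cases "v \<in> ?V")
    case True
    then show ?thesis using g\<theta>[OF gV[OF True]] g\<theta>[OF True] \<theta>(5)[OF True] by simp
  qed (simp add: g_def)
  have gE: "g ` e \<in> E" if "e \<in> E" for e
  proof -
    obtain u v where e: "e = {u, v}" using E[OF \<open>e \<in> E\<close>] by (meson card_2_iff)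
    then have "u \<in> ?V" "v \<in> ?V" using E[OF \<open>e \<in> E\<close>] by auto
    then show ?thesis using \<theta>(3)[of u v] that by (simp add: e g\<theta>)
  qed
  have fixed: "fixed_edges E (\<theta> \<gamma>) = {e \<in> E. g ` e = e}"
  proof -
    have "(\<exists>i j. e = {i, j} \<and> (\<theta> 1 i = i \<and> \<theta> 1 j = j \<or> \<theta> 1 i = j \<and> \<theta> 1 j = i)) \<longleftrightarrow> g ` e = e"
      if eE: "e \<in> E" for e
    proof
      assume "\<exists>i j. e = {i, j} \<and> (\<theta> 1 i = i \<and> \<theta> 1 j = j \<or> \<theta> 1 i = j \<and> \<theta> 1 j = i)"
      then obtain i j where e: "e = {i, j}" "\<theta> 1 i = i \<and> \<theta> 1 j = j \<or> \<theta> 1 i = j \<and> \<theta> 1 j = i" by blast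
      then have "i \<in> ?V" "j \<in> ?V" using E[OF eE] by auto
      then show "g ` e = e" using e by (auto simp: g\<theta>)
    next
      assume ge: "g ` e = e"
      obtain i j where e: "e = {i, j}" using E[OF eE] by (meson card_2_iff)
      then have V: "i \<in> ?V" "j \<in> ?V" using E[OF eE] by auto
      have "{g i, g j} = {i, j}" using ge e by simp
      then show "\<exists>i j. e = {i, j} \<and> (\<theta> 1 i = i \<and> \<theta> 1 j = j \<or> \<theta> 1 i = j \<and> \<theta> 1 j = i)"
        using e unfolding doubleton_eq_iff g\<theta>[OF V(1)] g\<theta>[OF V(2)] by blast
    qed
    then show ?thesis unfolding fixed_edges_def \<gamma> by blast
  qed
  have pg: "p (g v) = - p v" if "v \<in> VP" for v
    using sym that unfolding Z2_symmetric_def by (auto simp: carrier_Z2 \<tau> g_def)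
  show ?thesis
  proof
    assume iso: "isostatic VP VH E p L"
    have dual: "\<exists>m\<in>supported_on ?V. edge_functional VP p ?a e m \<noteq> 0 \<and>
        (\<forall>e'\<in>E - {e}. edge_functional VP p ?a e' m = 0)" if "e \<in> E" for e
      using isostatic_dual_flex[OF G unit iso that] by metis
    \<comment> \<open>Dual vectors for all edges remain dual for any subset, so the equations of
      every subgraph are independent.\<close>
    have count: "2 * card C = dim (flexes VP C F p ?a) + card F"
      if "F \<subseteq> E" "\<And>e. e \<in> F \<Longrightarrow> e \<subseteq> C" for C F
    proof (rule dim_flexes_independent)
      show "e \<subseteq> C \<and> card e = 2" if "e \<in> F" for e
        using that \<open>F \<subseteq> E\<close> E \<open>\<And>e. e \<in> F \<Longrightarrow> e \<subseteq> C\<close> by blast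
      show "\<exists>m. edge_functional VP p ?a e m \<noteq> 0 \<and> (\<forall>e'\<in>F - {e}. edge_functional VP p ?a e' m = 0)"
        if "e \<in> F" for e
      proof -
        have "e \<in> E" using that \<open>F \<subseteq> E\<close> by blast
        then obtain m where "edge_functional VP p ?a e m \<noteq> 0"
          "\<forall>e'\<in>E - {e}. edge_functional VP p ?a e' m = 0" using dual[of e] by auto
        then show ?thesis using \<open>F \<subseteq> E\<close> by (intro exI[of _ m]) auto
      qed
    qed
    have "dim (flexes VP ?V E p ?a) = 3"
      using iso dim_infinitesimal_motions[OF G unit] by (simp add: isostatic_def infinitesimally_rigid_def)
    moreover have "2 * card ?V = dim (flexes VP ?V E p ?a) + card E" using E by (intro count) auto
    ultimately have cardE: "card E + 3 = 2 * card ?V" by simp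
    have "tight_2_3 ?V E"
      unfolding tight_2_3_def
    proof (intro conjI allI impI)
      show "int (card E) = 2 * int (card ?V) - 3" using cardE by linarith
      fix C F assume CF: "C \<subseteq> ?V \<and> F \<subseteq> E \<and> (\<forall>e\<in>F. e \<subseteq> C) \<and> 0 < card F"
      then obtain e where e: "e \<in> F" by (metis card.empty ex_in_conv less_irrefl)
      have FC: "e \<subseteq> C \<and> card e = 2" if "e \<in> F" for e using CF that E by blast
      obtain m where m: "edge_functional VP p ?a e m \<noteq> 0" using dual[of e] e CF by auto
      have "3 \<le> dim (flexes VP C F p ?a)" by (rule dim_flexes_ge_3[OF FC e m])
      moreover have "2 * card C = dim (flexes VP C F p ?a) + card F" using CF by (intro count) auto
      ultimately show "int (card F) \<le> 2 * int (card C) - 3" by linarith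
    qed
    moreover have "card {e \<in> E. g ` e = e} = 1"
    proof -
      have ne: "E \<noteq> {}"
      proof
        assume "E = {}"
        then have "2 * card ?V = 3" using cardE by simp
        then show False by presburger
      qed
      have "card E + card {e \<in> E. g ` e = e} + 2 \<le> 2 * card ?V"
        by (rule card_fixed_edges_le[OF disj E gg gP gH gE pg dual ne])
      then have "card {e \<in> E. g ` e = e} \<le> 1" using cardE by linarith
      \<comment> \<open>\<open>card E\<close> is odd and the edges that are not fixed come in pairs,
        so the number of fixed edges is odd.\<close>
      moreover obtain R :: "'v set set" where "card E = card {e \<in> E. g ` e = e} + 2 * card R"
      proof (rule involution_representatives[of E "(`) g"])
        show "g ` e \<in> E" "g ` g ` e = e" if "e \<in> E" for e using gE[OF that] by (auto simp: image_image gg)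
      qed
      ultimately show ?thesis using cardE by presburger
    qed
    ultimately show "tight_2_3 ?V E \<and> card (fixed_edges E (\<theta> \<gamma>)) = 1" by (simp add: fixed)
  next
    assume tight: "tight_2_3 ?V E \<and> card (fixed_edges E (\<theta> \<gamma>)) = 1"
    have cardE: "card E + 3 = 2 * card ?V"
      using tight unfolding tight_2_3_def by linarith
    have sparse: "card F + 3 \<le> 2 * card C"
      if "C \<subseteq> ?V" "F \<subseteq> E" "F \<noteq> {}" "\<And>e. e \<in> F \<Longrightarrow> e \<subseteq> C" for C F
    proof -
      have "card F > 0" using that(3) by (simp add: card_gt_0_iff)
      then have "int (card F) \<le> 2 * int (card C) - 3"
        using that by (intro conjunct2[OF conjunct1[OF tight, unfolded tight_2_3_def], rule_format]) simp
      then show ?thesis by linarith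
    qed
    have fix1: "card {e \<in> E. g ` e = e} = 1" using tight by (simp add: fixed)
    \<comment> \<open>One edge on two points is also tight, but two points do not affinely span the
      plane.\<close>
    have big: "3 \<le> card VP" if "VH = {}"
    proof -
      have "affine hull (p ` VP) = UNIV" using hull that by simp
      then have "aff_dim (p ` VP) = 2" using aff_dim_affine_hull[of "p ` VP"] by simp
      moreover have "aff_dim (p ` VP) \<le> int (card (p ` VP)) - 1" by (intro aff_dim_le_card) simp
      moreover have "card (p ` VP) \<le> card VP" by (intro card_image_le) simp
      ultimately show ?thesis by linarith
    qed
    obtain p' L' where fw': "point_line_framework VP VH E p' L'" and pg': "\<forall>v. p' (g v) = - p' v"
      and dim': "dim (flexes VP ?V E p' (\<lambda>j. fst (L' j))) \<le> 3"
      by (rule half_turn_symmetric_rigid_realisation[OF disj E gg gP gH gE cardE sparse fix1 big])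
    have "Z2_symmetric VP VH \<theta> \<tau> p' L'"
      unfolding Z2_symmetric_def
    proof (intro ballI conjI)
      fix \<delta> i assume \<delta>: "\<delta> \<in> carrier Z2" and i: "i \<in> VP"
      then show "\<tau> \<delta> (p' i) = p' (\<theta> \<delta> i)"
        using pg'[rule_format, of i] i \<theta>(4)[of i] by (auto simp: carrier_Z2 \<tau> g_def)
    next
      fix \<delta> j assume \<delta>: "\<delta> \<in> carrier Z2" and j: "j \<in> VH"
      have j1: "\<theta> 1 j = j" "\<theta> 0 j = j" using assms(6) \<theta>(4)[of j] j by (auto simp: \<gamma>)
      then show "\<tau> \<delta> (fst (L' j)) = fst (L' (\<theta> \<delta> j)) \<or> \<tau> \<delta> (fst (L' j)) = - fst (L' (\<theta> \<delta> j))"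
        "snd (L' j) = snd (L' (\<theta> \<delta> j))"
        using \<delta> by (auto simp: carrier_Z2 \<tau>)
    qed
    \<comment> \<open>By regularity the given framework has at least the rank of the constructed
      one, hence no more motions.\<close>
    from max[OF fw' this] have "dim (infinitesimal_motions VP VH E p L) \<le> dim (infinitesimal_motions VP VH E p' L')"
      by (rule dim_motions_antimono_rank[OF G])
    also have "\<dots> \<le> 3"
      using fw' dim' dim_infinitesimal_motions[OF G, of L' p'] by (auto simp: point_line_framework_def)
    finally have le3: "dim (flexes VP ?V E p ?a) \<le> 3" by (simp add: dim_infinitesimal_motions[OF G unit])
    have "2 * card ?V \<le> dim (flexes VP ?V E p ?a) + card E" by (rule dim_flexes_ge)
    then have "infinitesimally_rigid VP VH E p L"
      using le3 cardE by (simp add: infinitesimally_rigid_def dim_infinitesimal_motions[OF G unit])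
    moreover have "\<not> infinitesimally_rigid VP VH (E - {e}) p L" if "e \<in> E" for e
    proof -
      have G': "point_line_graph VP VH (E - {e})" using G by (auto simp: point_line_graph_def)
      \<comment> \<open>Only \<open>2 * card ?V - 4\<close> edge equations are left, so the space of
        motions has dimension at least 4.\<close>
      have "2 * card ?V \<le> dim (flexes VP ?V (E - {e}) p ?a) + card (E - {e})" by (rule dim_flexes_ge)
      moreover have "card (E - {e}) + 1 = card E" using card_Suc_Diff1[OF finite that] by linarith
      ultimately show ?thesis
        using cardE by (simp add: infinitesimally_rigid_def dim_infinitesimal_motions[OF G' unit])
    qed
    ultimately show "isostatic VP VH E p L" by (simp add: isostatic_def)
  qed
qed

end
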